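(* Let $0<\lambda\leq 1$, and for $i=1,2$ let $A_i,B_i$ be strictly positive operators on a Hilbert space $\mathcal{H}_i$. (1) If $0<A_i\leq B_i$ for $i=1,2$, then (a) $T_{\lambda}(A_1\otimes A_2\vert B_1\otimes B_2)\geq \lambda\,T_{\lambda}(A_1\vert B_1)\otimes T_{\lambda}(A_2\vert B_2)$; (b) $T_{\lambda}(A_1\otimes A_2\vert B_1\otimes B_2)\geq T_{\lambda}(A_1\vert B_1)\otimes A_2+A_1\otimes T_{\lambda}(A_2\vert B_2)$. (2) If $0<B_i\leq A_i$ for $i=1,2$, then (c) $T_{\lambda}(A_1\otimes A_2\vert B_1\otimes B_2)\leq \lambda\,T_{\lambda}(A_1\vert B_1)\otimes T_{\lambda}(A_2\vert B_2)$; (d) $T_{\lambda}(A_1\otimes A_2\vert B_1\otimes B_2)\geq T_{\lambda}(A_1\vert B_1)\otimes A_2+A_1\otimes T_{\lambda}(A_2\vert B_2)$.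
   Context: Operators are bounded linear operators on a Hilbert space; $X\leq Y$ means that $Y-X$ is positive (semidefinite), and strictly positive ($X>0$) means positive and invertible. For strictly positive operators $A,B$ on the same Hilbert space and $\lambda\in(0,1]$, the Tsallis relative operator entropy is $T_{\lambda}(A\vert B):=\frac{1}{\lambda}\left(A^{1/2}(A^{-1/2}BA^{-1/2})^{\lambda}A^{1/2}-A\right)$. The symbol $\otimes$ denotes the tensor product of operators, acting on the Hilbert space tensor product $\mathcal{H}_1\otimes\mathcal{H}_2$. *)

theory Defs
  imports
    "HOL-Analysis.Analysis"
    "HOL-Computational_Algebra.Polynomial"
begin

section \<open>Complex Hilbert spaces\<close>

class scaleC =
  fixes scaleC :: "complex \<Rightarrow> 'a \<Rightarrow> 'a"  (infixr \<open>*\<^sub>C\<close> 75)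

text \<open>The inner product is conjugate linear in its first argument and linear in its second.
  The trivial space is a Hilbert space.\<close>

class chilbert_space = banach + scaleC +
  fixes cinner :: "'a \<Rightarrow> 'a \<Rightarrow> complex"
  assumes scaleC_add_right: "c *\<^sub>C (x + y) = c *\<^sub>C x + c *\<^sub>C y"
    and scaleC_add_left: "(c + d) *\<^sub>C x = c *\<^sub>C x + d *\<^sub>C x"
    and scaleC_scaleC: "c *\<^sub>C d *\<^sub>C x = (c * d) *\<^sub>C x"
    and scaleC_of_real: "complex_of_real r *\<^sub>C x = r *\<^sub>R x"
    and cinner_commute: "cinner x y = cnj (cinner y x)"
    and cinner_add_right: "cinner x (y + z) = cinner x y + cinner x z"
    and cinner_scaleC_right: "cinner x (c *\<^sub>C y) = c * cinner x y"
    and cinner_self: "cinner x x = complex_of_real ((norm x)\<^sup>2)"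

lemma cinner_add_left: "cinner (x + y) z = cinner x z + cinner y z"
  by (metis cinner_commute cinner_add_right complex_cnj_add)

lemma cinner_scaleC_left: "cinner (c *\<^sub>C x) y = cnj c * cinner x y"
  by (metis cinner_commute cinner_scaleC_right complex_cnj_mult)

lemma cinner_scaleR_right: "cinner x (r *\<^sub>R y) = complex_of_real r * cinner x y"
  by (metis cinner_scaleC_right scaleC_of_real)

lemma cinner_zero_right [simp]: "cinner x 0 = 0"
  using cinner_add_right[of x 0 0] by simp

lemma cinner_minus_right: "cinner x (- y) = - cinner x y"
  using cinner_scaleR_right[of x "-1" y] by simp

lemma scaleC_zero_right [simp]: "c *\<^sub>C (0::'a::chilbert_space) = 0"
  using scaleC_add_right[of c "0::'a" 0] by simp

lemma scaleC_scaleR_commute: "c *\<^sub>C r *\<^sub>R (x::'a::chilbert_space) = r *\<^sub>R c *\<^sub>C x"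
  by (simp add: scaleC_of_real[symmetric] scaleC_scaleC mult.commute)

lemma scaleC_minus_right: "c *\<^sub>C (- x::'a::chilbert_space) = - (c *\<^sub>C x)"
  using scaleC_scaleR_commute[of c "-1" x] by simp

lemma norm_scaleC: "norm (c *\<^sub>C (x::'a::chilbert_space)) = cmod c * norm x"
proof -
  have "complex_of_real ((norm (c *\<^sub>C x))\<^sup>2) = (c * cnj c) * complex_of_real ((norm x)\<^sup>2)"
    unfolding cinner_self[symmetric] by (simp add: cinner_scaleC_left cinner_scaleC_right)
  also have "\<dots> = complex_of_real ((cmod c * norm x)\<^sup>2)"
    unfolding complex_norm_square[symmetric] by (simp add: power_mult_distrib)
  finally have "(norm (c *\<^sub>C x))\<^sup>2 = (cmod c * norm x)\<^sup>2"
    unfolding of_real_eq_iff .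
  then show ?thesis
    by (simp add: power2_eq_iff_nonneg)
qed

lemma bounded_linear_scaleC: "bounded_linear (\<lambda>x::'a::chilbert_space. c *\<^sub>C x)"
  by (rule bounded_linear_intro[where K = "cmod c"])
    (simp_all add: scaleC_add_right scaleC_scaleR_commute norm_scaleC mult.commute)

section \<open>Bounded linear operators\<close>

typedef (overloaded) 'a bop =
  "{F :: ('a::chilbert_space) \<Rightarrow>\<^sub>L 'a. \<forall>c x. blinfun_apply F (c *\<^sub>C x) = c *\<^sub>C blinfun_apply F x}"
  morphisms blinfun_of_bop Bop
  by (rule exI[of _ 0]) simp

setup_lifting type_definition_bop

lift_definition bop_apply :: "'a::chilbert_space bop \<Rightarrow> 'a \<Rightarrow> 'a" is blinfun_apply .

lemma bop_apply_scaleC: "bop_apply X (c *\<^sub>C x) = c *\<^sub>C bop_apply X x"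
  by transfer simp

lemma bop_eqI: "(\<And>x. bop_apply X x = bop_apply Y x) \<Longrightarrow> X = Y"
  by transfer (rule blinfun_eqI)

text \<open>The norm is the operator norm; convergence of operators is norm convergence.\<close>

instantiation bop :: (chilbert_space) real_normed_vector
begin
lift_definition norm_bop :: "'a bop \<Rightarrow> real" is norm .
lift_definition zero_bop :: "'a bop" is 0 by simp
lift_definition plus_bop :: "'a bop \<Rightarrow> 'a bop \<Rightarrow> 'a bop" is "(+)"
  by (simp add: blinfun.add_left scaleC_add_right)
lift_definition uminus_bop :: "'a bop \<Rightarrow> 'a bop" is uminus
  by (simp add: blinfun.minus_left scaleC_minus_right)
lift_definition minus_bop :: "'a bop \<Rightarrow> 'a bop \<Rightarrow> 'a bop" is "(-)"
  by (metis (no_types, lifting) add_uminus_conv_diff blinfun.add_left blinfun.minus_left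
      scaleC_add_right scaleC_minus_right)
lift_definition scaleR_bop :: "real \<Rightarrow> 'a bop \<Rightarrow> 'a bop" is "(*\<^sub>R)"
  by (simp add: blinfun.scaleR_left scaleC_scaleR_commute)
definition dist_bop :: "'a bop \<Rightarrow> 'a bop \<Rightarrow> real" where
  "dist_bop X Y = norm (X - Y)"
definition sgn_bop :: "'a bop \<Rightarrow> 'a bop" where
  "sgn_bop X = inverse (norm X) *\<^sub>R X"
definition uniformity_bop :: "('a bop \<times> 'a bop) filter" where
  "uniformity_bop = (INF e\<in>{0<..}. principal {(X, Y). dist X Y < e})"
definition open_bop :: "'a bop set \<Rightarrow> bool" where
  "open_bop U = (\<forall>X\<in>U. eventually (\<lambda>(X', Y). X' = X \<longrightarrow> Y \<in> U) uniformity)"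
instance
proof
  fix X Y Z :: "'a bop" and a b :: real
  show "X + Y + Z = X + (Y + Z)" by transfer (simp add: add.assoc)
  show "X + Y = Y + X" by transfer (simp add: add.commute)
  show "0 + X = X" by transfer simp
  show "- X + X = 0" by transfer simp
  show "X - Y = X + - Y" by transfer simp
  show "a *\<^sub>R (X + Y) = a *\<^sub>R X + a *\<^sub>R Y" by transfer (simp add: scaleR_add_right)
  show "(a + b) *\<^sub>R X = a *\<^sub>R X + b *\<^sub>R X" by transfer (simp add: scaleR_add_left)
  show "a *\<^sub>R b *\<^sub>R X = (a * b) *\<^sub>R X" by transfer simp
  show "1 *\<^sub>R X = X" by transfer simp
  show "(norm X = 0) = (X = 0)" by transfer simp
  show "norm (X + Y) \<le> norm X + norm Y" by transfer (rule norm_triangle_ineq)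
  show "norm (a *\<^sub>R X) = \<bar>a\<bar> * norm X" by transfer simp
qed (simp_all add: dist_bop_def sgn_bop_def uniformity_bop_def open_bop_def)
end

text \<open>The product of operators is composition.\<close>

instantiation bop :: (chilbert_space) "{real_normed_algebra, monoid_mult}"
begin
lift_definition one_bop :: "'a bop" is id_blinfun by simp
lift_definition times_bop :: "'a bop \<Rightarrow> 'a bop \<Rightarrow> 'a bop" is blinfun_compose by simp
instance
proof
  fix X Y Z :: "'a bop" and a :: real
  show "X * Y * Z = X * (Y * Z)" by transfer (auto intro!: blinfun_eqI)
  show "(X + Y) * Z = X * Z + Y * Z"
    by transfer (auto intro!: blinfun_eqI simp: blinfun.add_left)
  show "X * (Y + Z) = X * Y + X * Z"
    by transfer (auto intro!: blinfun_eqI simp: blinfun.add_left blinfun.add_right)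
  show "(a *\<^sub>R X) * Y = a *\<^sub>R (X * Y)"
    by transfer (auto intro!: blinfun_eqI simp: blinfun.scaleR_left)
  show "X * (a *\<^sub>R Y) = a *\<^sub>R (X * Y)"
    by transfer (auto intro!: blinfun_eqI simp: blinfun.scaleR_left blinfun.scaleR_right)
  show "1 * X = X" by transfer (auto intro!: blinfun_eqI)
  show "X * 1 = X" by transfer (auto intro!: blinfun_eqI)
  show "norm (X * Y) \<le> norm X * norm Y" by transfer (rule norm_blinfun_compose)
qed
end

lemma bop_apply_simps [simp]:
  "bop_apply 0 x = 0" "bop_apply 1 x = x"
  "bop_apply (X + Y) x = bop_apply X x + bop_apply Y x"
  "bop_apply (X - Y) x = bop_apply X x - bop_apply Y x"
  "bop_apply (- X) x = - bop_apply X x"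
  "bop_apply (r *\<^sub>R X) x = r *\<^sub>R bop_apply X x"
  "bop_apply (X * Y) x = bop_apply X (bop_apply Y x)"
  "bop_apply X (x + y) = bop_apply X x + bop_apply X y"
  by (transfer; simp add: blinfun.add_left blinfun.diff_left blinfun.minus_left
      blinfun.scaleR_left blinfun.add_right)+

instantiation bop :: (chilbert_space) scaleC
begin
lift_definition scaleC_bop :: "complex \<Rightarrow> 'a bop \<Rightarrow> 'a bop" is
  "\<lambda>c F. Blinfun (\<lambda>x. c *\<^sub>C blinfun_apply F x)"
  by (simp add: bounded_linear_Blinfun_apply
      bounded_linear_compose[OF bounded_linear_scaleC blinfun.bounded_linear_right]
      scaleC_scaleC mult.commute)
instance ..
end

lemma bop_apply_scaleC_left: "bop_apply (c *\<^sub>C X) x = c *\<^sub>C bop_apply X x"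
  by transfer (simp add: bounded_linear_Blinfun_apply
      bounded_linear_compose[OF bounded_linear_scaleC blinfun.bounded_linear_right])

section \<open>Positivity and the operator order\<close>

text \<open>On a complex space, a nonnegative quadratic form forces the operator to be self-adjoint.\<close>

definition positive_op :: "'a::chilbert_space bop \<Rightarrow> bool" where
  "positive_op X \<longleftrightarrow> (\<forall>x. cinner x (bop_apply X x) \<in> \<real>\<^sub>\<ge>\<^sub>0)"

definition invertible_op :: "'a::chilbert_space bop \<Rightarrow> bool" where
  "invertible_op X \<longleftrightarrow> (\<exists>Y. X * Y = 1 \<and> Y * X = 1)"

definition strictly_positive :: "'a::chilbert_space bop \<Rightarrow> bool" where
  "strictly_positive X \<longleftrightarrow> positive_op X \<and> invertible_op X"

lemma bop_quadratic_form_zero: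
  fixes X :: "'a::chilbert_space bop"
  assumes q: "\<And>x. cinner x (bop_apply X x) = 0"
  shows "X = 0"
proof (rule bop_eqI)
  fix y :: 'a
  have s: "cinner x (bop_apply X y) + cinner y (bop_apply X x) = 0" for x y
    using q[of "x + y"] q[of x] q[of y] by (simp add: cinner_add_left cinner_add_right add.commute)
  have "cinner x (bop_apply X y) = 0" for x
    using s[of x y] s[of x "\<i> *\<^sub>C y"]
    by (simp add: bop_apply_scaleC cinner_scaleC_left cinner_scaleC_right)
  then have "cinner (bop_apply X y) (bop_apply X y) = 0" .
  then show "bop_apply X y = bop_apply 0 y"
    by (simp add: cinner_self)
qed

instantiation bop :: (chilbert_space) ordered_ab_group_add
begin
definition less_eq_bop :: "'a bop \<Rightarrow> 'a bop \<Rightarrow> bool" where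
  "X \<le> Y \<longleftrightarrow> positive_op (Y - X)"
text \<open>This is the strict part of the order; it is not strict positivity of the difference.\<close>
definition less_bop :: "'a bop \<Rightarrow> 'a bop \<Rightarrow> bool" where
  "X < Y \<longleftrightarrow> X \<le> Y \<and> \<not> (Y::'a bop) \<le> X"
instance
proof
  fix X Y Z :: "'a bop"
  show "(X < Y) = (X \<le> Y \<and> \<not> Y \<le> X)"
    by (fact less_bop_def)
  show "X \<le> X"
    by (simp add: less_eq_bop_def positive_op_def)
  show "X \<le> Y \<Longrightarrow> Z + X \<le> Z + Y"
    by (simp add: less_eq_bop_def)
  show "X \<le> Z" if "X \<le> Y" "Y \<le> Z"
  proof -
    have "cinner x (bop_apply (Z - X) x)
        = cinner x (bop_apply (Z - Y) x) + cinner x (bop_apply (Y - X) x)" for x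
      by (simp add: cinner_add_right[symmetric])
    then show ?thesis
      using that by (simp add: less_eq_bop_def positive_op_def del: bop_apply_simps)
  qed
  show "X = Y" if "X \<le> Y" "Y \<le> X"
  proof -
    have "cinner x (bop_apply (Y - X) x) = 0" for x
    proof -
      have "cinner x (bop_apply (X - Y) x) = - cinner x (bop_apply (Y - X) x)"
        by (simp add: cinner_minus_right[symmetric])
      with that have "cinner x (bop_apply (Y - X) x) \<in> \<real>\<^sub>\<ge>\<^sub>0"
          "- cinner x (bop_apply (Y - X) x) \<in> \<real>\<^sub>\<ge>\<^sub>0"
        unfolding less_eq_bop_def positive_op_def by metis+
      then show ?thesis
        by (auto simp: complex_nonneg_Reals_iff complex_eq_iff)
    qed
    then have "Y - X = 0"
      by (rule bop_quadratic_form_zero)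
    then show ?thesis by simp
  qed
qed
end

section \<open>Real powers\<close>

definition op_spectrum :: "'a::chilbert_space bop \<Rightarrow> complex set" where
  "op_spectrum X = {c. \<not> invertible_op (X - c *\<^sub>C 1)}"

definition poly_op :: "real poly \<Rightarrow> 'a::chilbert_space bop \<Rightarrow> 'a bop" where
  "poly_op p X = (\<Sum>i\<le>degree p. coeff p i *\<^sub>R X ^ i)"

text \<open>The continuous functional calculus, meant for self-adjoint \<open>X\<close> (whose spectrum is real)
  and \<open>f\<close> continuous on the spectrum: \<open>f(X)\<close> is the norm limit of \<open>p\<^sub>n(X)\<close> for polynomials
  \<open>p\<^sub>n\<close> converging to \<open>f\<close> uniformly on the spectrum.\<close>

definition cfc :: "(real \<Rightarrow> real) \<Rightarrow> 'a::chilbert_space bop \<Rightarrow> 'a bop" where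
  "cfc f X = (THE Y. \<exists>p. uniform_limit {t. complex_of_real t \<in> op_spectrum X}
      (\<lambda>n. poly (p n)) f sequentially \<and> (\<lambda>n. poly_op (p n) X) \<longlonglongrightarrow> Y)"

definition op_powr :: "'a::chilbert_space bop \<Rightarrow> real \<Rightarrow> 'a bop"  (infixr \<open>powr\<^sub>o\<^sub>p\<close> 80) where
  "X powr\<^sub>o\<^sub>p s = cfc (\<lambda>t. t powr s) X"

definition tsallis :: "real \<Rightarrow> 'a::chilbert_space bop \<Rightarrow> 'a bop \<Rightarrow> 'a bop" where
  "tsallis l A B = (1 / l) *\<^sub>R
     (A powr\<^sub>o\<^sub>p (1/2) * (A powr\<^sub>o\<^sub>p (-1/2) * B * A powr\<^sub>o\<^sub>p (-1/2)) powr\<^sub>o\<^sub>p l * A powr\<^sub>o\<^sub>p (1/2) - A)"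

section \<open>Hilbert space tensor products\<close>

text \<open>A Hilbert space \<open>'c\<close> with a map \<open>\<otimes>\<close> as below is the Hilbert space tensor product of
  \<open>'a\<close> and \<open>'b\<close>, up to a unique unitary isomorphism compatible with \<open>\<otimes>\<close>. As
  \<open>c *\<^sub>C (x \<otimes> y) = (c *\<^sub>C x) \<otimes> y\<close>, the real linear span of the simple tensors
  is their complex linear span.\<close>

definition hilbert_tensor ::
    "('a::chilbert_space \<Rightarrow> 'b::chilbert_space \<Rightarrow> 'c::chilbert_space) \<Rightarrow> bool" where
  "hilbert_tensor tens \<longleftrightarrow>
     (\<forall>x x' y. tens (x + x') y = tens x y + tens x' y) \<and>
     (\<forall>x y y'. tens x (y + y') = tens x y + tens x y') \<and>
     (\<forall>c x y. tens (c *\<^sub>C x) y = c *\<^sub>C tens x y) \<and>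
     (\<forall>c x y. tens x (c *\<^sub>C y) = c *\<^sub>C tens x y) \<and>
     (\<forall>x x' y y'. cinner (tens x y) (tens x' y') = cinner x x' * cinner y y') \<and>
     closure (span {tens x y | x y. True}) = UNIV"

definition tensor_op ::
    "'a::chilbert_space bop \<Rightarrow> ('a \<Rightarrow> 'b::chilbert_space \<Rightarrow> 'c::chilbert_space) \<Rightarrow>
      'b bop \<Rightarrow> 'c bop"  (\<open>_ \<otimes>\<^bsub>_\<^esub> _\<close> [71, 0, 71] 70) where
  "A \<otimes>\<^bsub>tens\<^esub> B =
     (THE C. \<forall>x y. bop_apply C (tens x y) = tens (bop_apply A x) (bop_apply B y))"

end

theory Submission
  imports Defs "HOL-Computational_Algebra.Fundamental_Theorem_Algebra"
begin

text \<open>Let \<open>G\<^sub>i\<close> be the \<open>\<lambda>\<close>-weighted geometric mean of \<open>A\<^sub>i\<close> and \<open>B\<^sub>i\<close>, and \<open>D\<^sub>i = G\<^sub>i - A\<^sub>i\<close>, so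
  that \<open>T\<^sub>\<lambda>(A\<^sub>i|B\<^sub>i) = D\<^sub>i / \<lambda>\<close>. Real powers commute with tensor products, hence
  \<open>\<lambda> T\<^sub>\<lambda>(A\<^sub>1 \<otimes> A\<^sub>2|B\<^sub>1 \<otimes> B\<^sub>2) = G\<^sub>1 \<otimes> G\<^sub>2 - A\<^sub>1 \<otimes> A\<^sub>2 = D\<^sub>1 \<otimes> D\<^sub>2 + D\<^sub>1 \<otimes> A\<^sub>2 + A\<^sub>1 \<otimes> D\<^sub>2\<close>.
  Both \<open>D\<^sub>i\<close> are positive if \<open>A\<^sub>i \<le> B\<^sub>i\<close> and negative if \<open>B\<^sub>i \<le> A\<^sub>i\<close>; the first summand is positive in
  either case, and the other two have the sign of the \<open>D\<^sub>i\<close>.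

  That powers commute with tensor products follows from the uniqueness of positive square roots:
  \<open>s \<mapsto> X\<^sup>s \<otimes> Y\<^sup>s\<close> is a semigroup of positive operators, so it agrees with \<open>(X \<otimes> Y)\<^sup>s\<close> at dyadic
  \<open>s\<close>, and by continuity everywhere.\<close>

section \<open>Self-adjoint and positive operators\<close>

lemma cinner_zero_left [simp]: "cinner 0 (y::'a::chilbert_space) = 0"
  by (metis cinner_commute cinner_zero_right complex_cnj_zero)

lemma cinner_minus_left: "cinner (- x) (y::'a::chilbert_space) = - cinner x y"
  by (metis cinner_commute cinner_minus_right complex_cnj_minus)

lemma cinner_diff_right: "cinner x (y - z) = cinner x y - cinner x (z::'a::chilbert_space)"
  using cinner_add_right[of x y "- z"] by (simp add: cinner_minus_right)

lemma cinner_diff_left: "cinner (x - y) z = cinner x z - cinner y (z::'a::chilbert_space)"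
  using cinner_add_left[of x "- y" z] by (simp add: cinner_minus_left)

lemma cinner_scaleR_left: "cinner (r *\<^sub>R x) (y::'a::chilbert_space) = complex_of_real r * cinner x y"
  by (metis cinner_scaleC_left scaleC_of_real complex_cnj_complex_of_real)

definition selfadj :: "'a::chilbert_space bop \<Rightarrow> bool" where
  "selfadj X \<longleftrightarrow> (\<forall>x y. cinner (bop_apply X x) y = cinner x (bop_apply X y))"

lemma selfadjD: "selfadj X \<Longrightarrow> cinner (bop_apply X x) y = cinner x (bop_apply X y)"
  by (simp add: selfadj_def)

lemma selfadj_0 [simp]: "selfadj 0" and selfadj_1 [simp]: "selfadj 1"
  by (simp_all add: selfadj_def)

lemma selfadj_add: "selfadj X \<Longrightarrow> selfadj Y \<Longrightarrow> selfadj (X + Y)"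
  and selfadj_diff: "selfadj X \<Longrightarrow> selfadj Y \<Longrightarrow> selfadj (X - Y)"
  and selfadj_minus: "selfadj X \<Longrightarrow> selfadj (- X)"
  and selfadj_scaleR: "selfadj X \<Longrightarrow> selfadj (r *\<^sub>R X)"
  and selfadj_conjugate: "selfadj S \<Longrightarrow> selfadj X \<Longrightarrow> selfadj (S * X * S)"
  by (simp_all add: selfadj_def cinner_add_left cinner_add_right cinner_diff_left
      cinner_diff_right cinner_minus_left cinner_minus_right cinner_scaleR_left cinner_scaleR_right)

lemma selfadj_mult: "selfadj X \<Longrightarrow> selfadj Y \<Longrightarrow> X * Y = Y * X \<Longrightarrow> selfadj (X * Y)"
  unfolding selfadj_def by (metis bop_apply_simps(7))

lemma selfadj_real: "selfadj X \<Longrightarrow> cinner x (bop_apply X x) \<in> \<real>"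
  by (metis Reals_cnj_iff cinner_commute selfadjD)

text \<open>A real quadratic form makes the symmetry defect \<open>D\<close> vanish on the diagonal.
  \<open>D\<close> is sesquilinear, so polarizing with \<open>x + y\<close> and with
  \<open>x + \<i> *\<^sub>C y\<close> makes it vanish everywhere.\<close>

lemma positive_op_iff:
  "positive_op X \<longleftrightarrow> selfadj X \<and> (\<forall>x. 0 \<le> Re (cinner x (bop_apply X x)))"
proof
  assume pos: "positive_op X"
  define D where "D x y = cinner (bop_apply X x) y - cinner x (bop_apply X y)" for x y
  have D_add: "D (x + y) (x' + y') = D x x' + D x y' + D y x' + D y y'" for x y x' y'
    by (simp add: D_def cinner_add_left cinner_add_right)
  have q: "D x x = 0" for x
  proof -
    have "cinner x (bop_apply X x) \<in> \<real>"
      using pos nonneg_Reals_subset_Reals by (auto simp: positive_op_def)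
    then have "cnj (cinner x (bop_apply X x)) = cinner x (bop_apply X x)"
      by (simp add: Reals_cnj_iff)
    then show ?thesis
      by (simp add: D_def flip: cinner_commute)
  qed
  have s: "D x y + D y x = 0" for x y
    using D_add[of x y x y] by (simp add: q)
  have D_i: "D x (\<i> *\<^sub>C y) = \<i> * D x y" "D (\<i> *\<^sub>C y) x = - \<i> * D y x" for x y
    by (simp_all add: D_def cinner_scaleC_left cinner_scaleC_right bop_apply_scaleC algebra_simps)
  have "D x y = 0" for x y
    using s[of x y] s[of x "\<i> *\<^sub>C y"] by (simp add: D_i)
  then have "selfadj X"
    by (simp add: selfadj_def D_def)
  with pos show "selfadj X \<and> (\<forall>x. 0 \<le> Re (cinner x (bop_apply X x)))"
    by (auto simp: positive_op_def complex_nonneg_Reals_iff)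
next
  assume *: "selfadj X \<and> (\<forall>x. 0 \<le> Re (cinner x (bop_apply X x)))"
  then show "positive_op X"
    by (auto simp: positive_op_def complex_nonneg_Reals_iff
        dest: selfadj_real[THEN complex_is_Real_iff[THEN iffD1]])
qed

lemma positive_op_selfadj: "positive_op X \<Longrightarrow> selfadj X"
  by (simp add: positive_op_iff)

lemma positive_op_add: "positive_op X \<Longrightarrow> positive_op Y \<Longrightarrow> positive_op (X + Y)"
  by (simp add: positive_op_iff selfadj_add cinner_add_right)

lemma positive_op_scaleR: "positive_op X \<Longrightarrow> 0 \<le> r \<Longrightarrow> positive_op (r *\<^sub>R X)"
  by (simp add: positive_op_iff selfadj_scaleR cinner_scaleR_right)

lemma positive_op_conjugate: "selfadj S \<Longrightarrow> positive_op X \<Longrightarrow> positive_op (S * X * S)"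
  by (simp add: positive_op_iff selfadj_conjugate) (metis selfadjD)

lemma positive_op_square: "selfadj S \<Longrightarrow> positive_op (S * S)"
  using positive_op_conjugate[of S 1] by (simp add: positive_op_iff cinner_self)

lemma le_op_iff:
  "selfadj X \<Longrightarrow> selfadj Y \<Longrightarrow>
     X \<le> Y \<longleftrightarrow> (\<forall>x. Re (cinner x (bop_apply X x)) \<le> Re (cinner x (bop_apply Y x)))"
  by (simp add: less_eq_bop_def positive_op_iff selfadj_diff cinner_diff_right)

section \<open>Norm bounds and Cauchy-Schwarz inequalities for operators\<close>

lemma bop_apply_minus_right: "bop_apply X (- x) = - bop_apply X x"
  using bop_apply_scaleC[of X "-1" x] by (metis scaleC_of_real of_real_1 of_real_minus scaleR_minus1_left)

lemma bop_apply_diff_right: "bop_apply X (x - y) = bop_apply X x - bop_apply X y"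
  using bop_apply_simps(8)[of X x "- y"] by (simp add: bop_apply_minus_right)

lemma bop_apply_zero_right [simp]: "bop_apply X 0 = 0"
  using bop_apply_diff_right[of X 0 0] by simp

lemma bop_apply_scaleR_right: "bop_apply X (r *\<^sub>R x) = r *\<^sub>R bop_apply X x"
  by (metis scaleC_of_real bop_apply_scaleC)

lemma norm_bop_apply: "norm (bop_apply X x) \<le> norm X * norm x"
  by transfer (rule norm_blinfun)

lemma norm_bop_bound: "0 \<le> b \<Longrightarrow> (\<And>x. norm (bop_apply X x) \<le> b * norm x) \<Longrightarrow> norm X \<le> b"
  by transfer (rule norm_blinfun_bound)

lemma bounded_linear_bop_apply_left: "bounded_linear (\<lambda>X. bop_apply X x)"
  by (rule bounded_linear_intro[where K = "norm x"]) (simp_all add: norm_bop_apply)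

lemma bounded_linear_bop_apply: "bounded_linear (bop_apply X)"
  by (rule bounded_linear_intro[where K = "norm X"])
    (simp_all add: norm_bop_apply mult.commute[of _ "norm X"] bop_apply_scaleR_right)

text \<open>The form of \<open>P\<close> at \<open>x + r *\<^sub>R y\<close> is a nonnegative real
  quadratic in \<open>r\<close>; its value at the minimizer gives the inequality. Later norm
  estimates come from a suitable choice of \<open>P\<close> and of the two vectors.\<close>

lemma cauchy_schwarz_positive_op:
  assumes "positive_op P"
  shows "(Re (cinner x (bop_apply P y)))\<^sup>2
    \<le> Re (cinner x (bop_apply P x)) * Re (cinner y (bop_apply P y))"
proof -
  let ?a = "Re (cinner x (bop_apply P x))" and ?b = "Re (cinner x (bop_apply P y))"
    and ?c = "Re (cinner y (bop_apply P y))"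
  have sym: "Re (cinner y (bop_apply P x)) = ?b"
    using assms by (metis cinner_commute cnj.simps(1) positive_op_selfadj selfadjD)
  have q: "0 \<le> ?a + 2 * r * ?b + r\<^sup>2 * ?c" for r
  proof -
    have "0 \<le> Re (cinner (x + r *\<^sub>R y) (bop_apply P (x + r *\<^sub>R y)))"
      using assms by (simp only: positive_op_iff)
    also have "\<dots> = ?a + 2 * r * ?b + r\<^sup>2 * ?c"
      by (simp add: bop_apply_scaleR_right cinner_add_left cinner_add_right cinner_scaleR_left
          cinner_scaleR_right sym power2_eq_square algebra_simps)
    finally show ?thesis .
  qed
  have c: "0 \<le> ?c"
    using assms by (simp add: positive_op_iff)
  show ?thesis
  proof (cases "?c = 0")
    case True
    have "?b = 0"
    proof (rule ccontr)
      assume "?b \<noteq> 0"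
      \<comment> \<open>When the leading coefficient is zero the quadratic is affine in
        \<open>r\<close>, and at this \<open>r\<close> its value is -1.\<close>
      then show False
        using q[of "- (?a + 1) / (2 * ?b)"] True by (simp add: field_simps)
    qed
    then show ?thesis using True by simp
  next
    case False
    then show ?thesis
      using q[of "- ?b / ?c"] c by (simp add: field_simps power2_eq_square)
  qed
qed

lemma positive_op_1 [simp]: "positive_op 1"
  by (simp add: positive_op_iff cinner_self)

lemma Re_cinner_le: "\<bar>Re (cinner x y)\<bar> \<le> norm x * norm (y::'a::chilbert_space)"
proof -
  have "(Re (cinner x y))\<^sup>2 \<le> (norm x * norm y)\<^sup>2"
    using cauchy_schwarz_positive_op[OF positive_op_1, of x y]
    by (simp add: cinner_self power_mult_distrib)
  then show ?thesis
    by (metis abs_le_square_iff abs_of_nonneg mult_nonneg_nonneg norm_ge_zero)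
qed

text \<open>Rotating \<open>y\<close> by the phase \<open>u\<close> of modulus one makes the inner
  product real and nonnegative, which reduces the claim to the bound on real parts.\<close>

lemma cmod_cinner_le: "cmod (cinner x y) \<le> norm x * norm (y::'a::chilbert_space)"
proof (cases "cinner x y = 0")
  case False
  define u where "u = cnj (cinner x y) / cmod (cinner x y)"
  have "Re (cinner x (u *\<^sub>C y)) = cmod (cinner x y)"
  proof -
    have "cinner x (u *\<^sub>C y) = (cinner x y * cnj (cinner x y)) / cmod (cinner x y)"
      by (simp add: cinner_scaleC_right u_def)
    then show ?thesis
      using False by (simp add: power2_eq_square flip: complex_norm_square)
  qed
  moreover have "norm (u *\<^sub>C y) = norm y"
    using False by (simp add: norm_scaleC u_def norm_divide)
  ultimately show ?thesis
    using Re_cinner_le[of x "u *\<^sub>C y"] by simp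
qed simp

lemma bounded_bilinear_cinner:
  "bounded_bilinear (cinner :: 'a::chilbert_space \<Rightarrow> 'a \<Rightarrow> complex)"
  by unfold_locales
    (auto simp: cinner_add_left cinner_add_right cinner_scaleR_left cinner_scaleR_right
      scaleR_conv_of_real cmod_cinner_le intro!: exI[of _ 1])

lemmas tendsto_cinner = bounded_bilinear.tendsto[OF bounded_bilinear_cinner]

lemma Re_cinner_bop_le: "Re (cinner x (bop_apply X x)) \<le> norm X * (norm x)\<^sup>2"
proof -
  have "Re (cinner x (bop_apply X x)) \<le> norm x * norm (bop_apply X x)"
    using Re_cinner_le[of x "bop_apply X x"] by linarith
  also have "\<dots> \<le> norm x * (norm X * norm x)"
    by (intro mult_left_mono norm_bop_apply) simp
  finally show ?thesis by (simp add: power2_eq_square mult_ac)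
qed

lemma le_scaleR_1_iff:
  "selfadj X \<Longrightarrow> X \<le> r *\<^sub>R 1 \<longleftrightarrow> (\<forall>x. Re (cinner x (bop_apply X x)) \<le> r * (norm x)\<^sup>2)"
  "selfadj X \<Longrightarrow> r *\<^sub>R 1 \<le> X \<longleftrightarrow> (\<forall>x. r * (norm x)\<^sup>2 \<le> Re (cinner x (bop_apply X x)))"
  by (simp_all add: le_op_iff selfadj_scaleR cinner_scaleR_right cinner_self)

lemma selfadj_le_norm: "selfadj X \<Longrightarrow> X \<le> norm X *\<^sub>R 1"
  by (simp add: le_scaleR_1_iff Re_cinner_bop_le)

lemma positive_op_iff_ge_0: "positive_op X \<longleftrightarrow> 0 \<le> X"
  by (simp add: less_eq_bop_def)

text \<open>Cauchy-Schwarz for the form of \<open>P\<close>, applied to \<open>P x\<close> and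
  \<open>x\<close>, bounds the fourth power of the norm of \<open>P x\<close> by
  \<open>k\<^sup>2\<close> times the squared norms of \<open>P x\<close> and
  \<open>x\<close>.\<close>

lemma norm_le_if_positive_op_le:
  assumes P: "positive_op P" and le: "P \<le> k *\<^sub>R 1" and k: "0 \<le> k"
  shows "norm P \<le> k"
proof (rule norm_bop_bound[OF k])
  fix x
  let ?y = "bop_apply P x"
  have le': "Re (cinner z (bop_apply P z)) \<le> k * (norm z)\<^sup>2" for z
    using le P by (simp add: le_scaleR_1_iff positive_op_selfadj)
  have "((norm ?y)\<^sup>2)\<^sup>2 = (Re (cinner ?y (bop_apply P x)))\<^sup>2"
    by (simp add: cinner_self)
  also have "\<dots> \<le> Re (cinner ?y (bop_apply P ?y)) * Re (cinner x (bop_apply P x))"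
    by (rule cauchy_schwarz_positive_op[OF P])
  also have "\<dots> \<le> (k * (norm ?y)\<^sup>2) * (k * (norm x)\<^sup>2)"
    using P k by (intro mult_mono le') (simp_all add: positive_op_iff)
  finally have "(norm ?y)\<^sup>2 * (norm ?y)\<^sup>2 \<le> (norm ?y)\<^sup>2 * (k * norm x)\<^sup>2"
    by (simp add: power2_eq_square mult_ac)
  then have "norm ?y = 0 \<or> (norm ?y)\<^sup>2 \<le> (k * norm x)\<^sup>2"
    by (metis mult_left_le_imp_le norm_zero zero_less_norm_iff zero_less_power)
  then show "norm ?y \<le> k * norm x"
    using k by (auto simp: abs_le_square_iff[symmetric])
qed

section \<open>Completeness, the Neumann series, and coercivity\<close>

instance bop :: (chilbert_space) banach
proof
  fix X :: "nat \<Rightarrow> 'a bop"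
  assume X: "Cauchy X"
  have d: "dist (blinfun_of_bop Y) (blinfun_of_bop Z) = dist Y Z" for Y Z :: "'a bop"
    unfolding dist_norm by transfer simp
  have "Cauchy (\<lambda>n. blinfun_of_bop (X n))"
    using X by (simp add: Cauchy_def d)
  then obtain F where F: "(\<lambda>n. blinfun_of_bop (X n)) \<longlonglongrightarrow> F"
    using Cauchy_convergent convergent_def by blast
  have ap: "(\<lambda>n. blinfun_apply (blinfun_of_bop (X n)) x) \<longlonglongrightarrow> blinfun_apply F x" for x
    using F by (intro tendsto_intros)
  \<comment> \<open>The embedding into real bounded linear maps is isometric, so it remains to see
    that complex linearity survives pointwise limits.\<close>
  have "blinfun_apply F (c *\<^sub>C x) = c *\<^sub>C blinfun_apply F x" for c x
  proof (rule LIMSEQ_unique[OF ap])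
    show "(\<lambda>n. blinfun_apply (blinfun_of_bop (X n)) (c *\<^sub>C x)) \<longlonglongrightarrow> c *\<^sub>C blinfun_apply F x"
      using bounded_linear.tendsto[OF bounded_linear_scaleC ap, of c x]
        blinfun_of_bop[of "X _"] by simp
  qed
  then have "blinfun_of_bop (Bop F) = F"
    by (simp add: Bop_inverse)
  with F have "X \<longlonglongrightarrow> Bop F"
    unfolding tendsto_iff by (metis (no_types, lifting) d eventually_mono)
  then show "convergent X"
    by (auto simp: convergent_def)
qed

lemma neumann_invertible:
  fixes Z :: "'a::chilbert_space bop"
  assumes "norm Z < 1"
  shows "invertible_op (1 - Z)"
proof -
  \<comment> \<open>The factor \<open>norm 1\<close> stays because it is 0 on the trivial
    space.\<close>
  have le: "norm (Z ^ n) \<le> norm (1::'a bop) * norm Z ^ n" for n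
  proof (induction n)
    case (Suc n)
    have "norm (Z ^ Suc n) \<le> norm Z * norm (Z ^ n)"
      by (simp add: norm_mult_ineq)
    also have "\<dots> \<le> norm Z * (norm (1::'a bop) * norm Z ^ n)"
      using Suc by (intro mult_left_mono) auto
    finally show ?case by (simp add: mult_ac)
  qed simp
  have sm: "summable (\<lambda>n. Z ^ n)"
    by (rule summable_comparison_test[OF _ summable_mult[OF summable_geometric[of "norm Z"]]])
      (use assms le in auto)
  let ?S = "\<Sum>n. Z ^ n"
  have split: "?S = 1 + (\<Sum>n. Z ^ Suc n)"
    using suminf_split_head[OF sm] by simp
  have "(\<Sum>n. Z ^ Suc n) = Z * ?S"
    using bounded_linear.suminf[OF bounded_linear_mult_right sm, of Z] by simp
  moreover have "(\<Sum>n. Z ^ Suc n) = ?S * Z"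
    using bounded_linear.suminf[OF bounded_linear_mult_left sm, of Z] by (simp add: power_commutes)
  ultimately have "(1 - Z) * ?S = 1" "?S * (1 - Z) = 1"
    using split by (simp_all add: algebra_simps)
  then show ?thesis
    by (auto simp: invertible_op_def)
qed

lemma invertible_op_mult: "invertible_op X \<Longrightarrow> invertible_op Y \<Longrightarrow> invertible_op (X * Y)"
  unfolding invertible_op_def
  by (metis (no_types, opaque_lifting) mult.assoc mult.right_neutral)

lemma invertible_op_scaleR: "invertible_op X \<Longrightarrow> r \<noteq> 0 \<Longrightarrow> invertible_op (r *\<^sub>R X)"
  unfolding invertible_op_def
  by (elim exE, rule_tac x = "inverse r *\<^sub>R Y" in exI) simp

text \<open>Write \<open>X\<close> as \<open>M *\<^sub>R (1 - Z)\<close>. Then \<open>Z\<close> lies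
  between 0 and \<open>1 - c / M\<close>, so its norm is below 1 and the Neumann series
  applies.\<close>

lemma coercive_invertible:
  assumes X: "selfadj X" and le: "c *\<^sub>R 1 \<le> X" and c: "0 < c"
  shows "invertible_op X"
proof -
  \<comment> \<open>The maximum with \<open>c\<close> keeps \<open>M\<close> positive and
    \<open>1 - c / M\<close> nonnegative even on the trivial space, where \<open>norm X\<close> is
    0.\<close>
  define M where "M = max c (norm X)"
  define Z where "Z = 1 - (1 / M) *\<^sub>R X"
  have M: "0 < M" "norm X \<le> M" "c \<le> M"
    using c by (auto simp: M_def)
  have Z: "selfadj Z"
    by (simp add: Z_def X selfadj_diff selfadj_scaleR)
  have "Re (cinner x (bop_apply X x)) \<le> M * (norm x)\<^sup>2" for x
    using Re_cinner_bop_le[of x X] M(2) by (meson mult_right_mono order_trans zero_le_power2)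
  then have pos: "positive_op Z"
    using M(1) Z by (simp add: positive_op_iff Z_def cinner_diff_right cinner_scaleR_right
        cinner_self field_simps)
  have "c * (norm x)\<^sup>2 \<le> Re (cinner x (bop_apply X x))" for x
    using le X by (simp add: le_scaleR_1_iff)
  then have "Z \<le> (1 - c / M) *\<^sub>R 1"
    using M(1) by (simp only: le_scaleR_1_iff[OF Z])
      (simp add: Z_def cinner_diff_right cinner_scaleR_right cinner_self field_simps)
  then have "norm Z \<le> 1 - c / M"
    using M by (intro norm_le_if_positive_op_le pos) simp_all
  also have "\<dots> < 1" using M(1) c by simp
  finally have "invertible_op (M *\<^sub>R (1 - Z))"
    using M(1) by (intro invertible_op_scaleR neumann_invertible) simp_all
  then show ?thesis
    using M(1) by (simp add: Z_def)
qed

text \<open>Cauchy-Schwarz for the form of \<open>X\<close> at \<open>x\<close> and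
  \<open>Y x\<close>, with \<open>Y\<close> the inverse, bounds the fourth power of
  \<open>norm x\<close> by the form at \<open>x\<close> times
  \<open>(norm Y + 1) * (norm x)\<^sup>2\<close>.\<close>

lemma strictly_positive_coercive:
  fixes X :: "'a::chilbert_space bop"
  assumes "strictly_positive X"
  obtains c where "0 < c" "c *\<^sub>R 1 \<le> X"
proof -
  from assms obtain Y where Y: "X * Y = 1" and X: "positive_op X"
    by (auto simp: strictly_positive_def invertible_op_def)
  \<comment> \<open>Adding 1 avoids division by zero when \<open>Y\<close> is 0 on the trivial
    space.\<close>
  define c where "c = 1 / (norm Y + 1)"
  have c: "0 < c" by (simp add: c_def add_nonneg_pos)
  have "c * (norm x)\<^sup>2 \<le> Re (cinner x (bop_apply X x))" for x
  proof -
    let ?y = "bop_apply Y x" and ?q = "Re (cinner x (bop_apply X x))"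
    have Xy: "bop_apply X ?y = x"
      by (metis Y bop_apply_simps(2,7))
    have "((norm x)\<^sup>2)\<^sup>2 = (Re (cinner x (bop_apply X ?y)))\<^sup>2"
      by (simp add: Xy cinner_self)
    also have "\<dots> \<le> ?q * Re (cinner ?y (bop_apply X ?y))"
      by (rule cauchy_schwarz_positive_op[OF X])
    also have "\<dots> = ?q * Re (cinner x ?y)"
      by (metis Xy cinner_commute cnj.simps(1))
    also have "\<dots> \<le> ?q * ((norm Y + 1) * (norm x)\<^sup>2)"
      using Re_cinner_bop_le[of x Y] X
      by (intro mult_left_mono) (auto simp: positive_op_iff distrib_right intro: order_trans)
    finally have "(norm x)\<^sup>2 * (norm x)\<^sup>2 \<le> (norm x)\<^sup>2 * (?q * (norm Y + 1))"
      by (simp add: power2_eq_square mult_ac)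
    then have "x = 0 \<or> (norm x)\<^sup>2 \<le> ?q * (norm Y + 1)"
      by (metis mult_left_le_imp_le zero_less_norm_iff zero_less_power)
    moreover have "0 < norm Y + 1" by (simp add: add_nonneg_pos)
    ultimately show ?thesis
      by (auto simp: c_def field_simps)
  qed
  then have "c *\<^sub>R 1 \<le> X"
    using X by (simp add: le_scaleR_1_iff positive_op_selfadj)
  with c show thesis by (rule that)
qed

lemma strictly_positive_if_coercive:
  fixes X :: "'a::chilbert_space bop"
  assumes X: "selfadj X" and le: "c *\<^sub>R 1 \<le> X" and c: "0 < c"
  shows "strictly_positive X"
proof -
  have "0 \<le> c * (norm x)\<^sup>2" for x :: 'a
    using c by simp
  then have "positive_op X"
    using X le unfolding le_scaleR_1_iff(2)[OF X] positive_op_iff by (meson order_trans)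
  then show ?thesis
    using coercive_invertible[OF assms] by (simp add: strictly_positive_def)
qed

lemma strictly_positive_selfadj: "strictly_positive X \<Longrightarrow> selfadj X"
  by (simp add: strictly_positive_def positive_op_selfadj)

lemma strictly_positive_add: 
  assumes X: "strictly_positive X" and Y: "positive_op Y"
  shows "strictly_positive (X + Y)"
proof -
  obtain c where c: "0 < c" "c *\<^sub>R 1 \<le> X"
    using strictly_positive_coercive[OF X] by blast
  have "c *\<^sub>R 1 \<le> X + Y"
    using add_mono[OF c(2) Y[unfolded positive_op_iff_ge_0]] by simp
  with c show ?thesis
    using X Y by (intro strictly_positive_if_coercive[of _ c] selfadj_add)
      (simp_all add: strictly_positive_selfadj positive_op_selfadj)
qed

section \<open>Polynomials of a self-adjoint operator\<close>

lemma poly_op_eq_sum: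
  assumes "degree p \<le> n"
  shows "poly_op p X = (\<Sum>i\<le>n. coeff p i *\<^sub>R X ^ i)"
  unfolding poly_op_def using assms
  by (intro sum.mono_neutral_left) (auto simp: coeff_eq_0)

lemma poly_op_0 [simp]: "poly_op 0 X = 0"
  by (simp add: poly_op_def)

text \<open>The Horner recursion opens \<open>poly_op\<close> to induction over polynomials.\<close>

lemma poly_op_pCons [simp]: "poly_op (pCons a p) X = a *\<^sub>R 1 + X * poly_op p X"
proof -
  have "poly_op (pCons a p) X = (\<Sum>i\<le>Suc (degree p). coeff (pCons a p) i *\<^sub>R X ^ i)"
    by (intro poly_op_eq_sum degree_pCons_le)
  also have "\<dots> = a *\<^sub>R 1 + X * poly_op p X"
    unfolding sum.atMost_Suc_shift by (simp add: poly_op_def sum_distrib_left)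
  finally show ?thesis .
qed

lemma poly_op_add: "poly_op (p + q) X = poly_op p X + poly_op q X"
proof (induction p q rule: poly_induct2)
  case (pCons a p b q)
  then show ?case by (simp add: algebra_simps)
qed simp

lemma poly_op_smult: "poly_op (smult a p) X = a *\<^sub>R poly_op p X"
  by (induction p) (simp_all add: algebra_simps)

lemma poly_op_minus: "poly_op (- p) X = - poly_op p X"
  using poly_op_smult[of "-1" p X] by simp

lemma poly_op_diff: "poly_op (p - q) X = poly_op p X - poly_op q X"
  using poly_op_add[of p "- q" X] by (simp add: poly_op_minus)

lemma poly_op_mult: "poly_op (p * q) X = poly_op p X * poly_op q X"
  by (induction p) (simp_all add: poly_op_add poly_op_smult algebra_simps)

lemma poly_op_commute: "X * Y = Y * X \<Longrightarrow> poly_op p X * Y = Y * poly_op p X"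
proof (induction p)
  case (pCons a p)
  then show ?case
    by (simp add: algebra_simps) (metis mult.assoc)
qed simp

lemma selfadj_poly_op: "selfadj X \<Longrightarrow> selfadj (poly_op p X)"
proof (induction p)
  case (pCons a p)
  then show ?case
    by (simp add: selfadj_add selfadj_scaleR selfadj_mult poly_op_commute)
qed simp

text \<open>This is the set on which \<open>cfc\<close> demands uniform convergence.\<close>

definition real_spectrum :: "'a::chilbert_space bop \<Rightarrow> real set" where
  "real_spectrum X = {t. complex_of_real t \<in> op_spectrum X}"

lemma real_spectrum_iff: "t \<in> real_spectrum X \<longleftrightarrow> \<not> invertible_op (X - t *\<^sub>R 1)"
proof -
  have "complex_of_real t *\<^sub>C (1::'a bop) = t *\<^sub>R 1"
    by (rule bop_eqI) (simp add: bop_apply_scaleC_left scaleC_of_real)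
  then show ?thesis
    by (simp add: real_spectrum_def op_spectrum_def)
qed

lemma real_spectrum_lower:
  assumes "selfadj X" "c *\<^sub>R 1 \<le> X" "t \<in> real_spectrum X"
  shows "c \<le> t"
proof (rule ccontr)
  assume "\<not> c \<le> t"
  moreover have "(c - t) *\<^sub>R 1 \<le> X - t *\<^sub>R 1"
    using assms(2) by (simp add: scaleR_left_diff_distrib)
  ultimately have "invertible_op (X - t *\<^sub>R 1)"
    using assms(1) by (intro coercive_invertible[of _ "c - t"] selfadj_diff selfadj_scaleR) auto
  with assms(3) show False by (simp add: real_spectrum_iff)
qed

lemma real_spectrum_upper:
  assumes "selfadj X" "X \<le> c *\<^sub>R 1" "t \<in> real_spectrum X"
  shows "t \<le> c"
proof (rule ccontr)
  assume "\<not> t \<le> c"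
  moreover have "(t - c) *\<^sub>R 1 \<le> t *\<^sub>R 1 - X"
    using assms(2) by (simp add: scaleR_left_diff_distrib)
  ultimately have "invertible_op (t *\<^sub>R 1 - X)"
    using assms(1) by (intro coercive_invertible[of _ "t - c"] selfadj_diff selfadj_scaleR) auto
  then have "invertible_op ((-1) *\<^sub>R (t *\<^sub>R 1 - X))"
    by (intro invertible_op_scaleR) simp_all
  with assms(3) show False by (simp add: real_spectrum_iff)
qed

lemma map_poly_of_real_add:
  "map_poly complex_of_real (p + q) = map_poly complex_of_real p + map_poly complex_of_real q"
  by (rule poly_eqI) (simp add: coeff_map_poly)

lemma map_poly_of_real_mult:
  "map_poly complex_of_real (p * q) = map_poly complex_of_real p * map_poly complex_of_real q"
  by (rule poly_eqI) (simp add: coeff_map_poly coeff_mult)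

lemma poly_map_poly_of_real:
  "poly (map_poly complex_of_real p) (complex_of_real t) = complex_of_real (poly p t)"
  by (induction p) (simp_all add: map_poly_pCons)

text \<open>Over the reals the polynomial splits into linear factors, handled by the hypothesis, and
  quadratic factors \<open>(t - a)\<^sup>2 + b\<^sup>2\<close> with \<open>b \<noteq> 0\<close>, whose value at \<open>X\<close> is at least \<open>b\<^sup>2\<close>.\<close>

lemma poly_op_invertible:
  fixes X :: "'a::chilbert_space bop"
  assumes X: "selfadj X"
  shows "q \<noteq> 0 \<Longrightarrow> (\<And>t. t \<in> real_spectrum X \<Longrightarrow> poly q t \<noteq> 0) \<Longrightarrow> invertible_op (poly_op q X)"
proof (induction "degree q" arbitrary: q rule: less_induct)
  case less
  have IH: "invertible_op (poly_op q X)"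
    if q: "q = d * r" and d: "invertible_op (poly_op d X)" "0 < degree d" for d r
  proof -
    have "r \<noteq> 0" "d \<noteq> 0" using less.prems(1) q by auto
    then have "invertible_op (poly_op r X)"
      using less.prems(2) q d(2) by (intro less.hyps) (auto simp: degree_mult_eq)
    then show ?thesis
      using d(1) by (simp add: q poly_op_mult invertible_op_mult)
  qed
  show ?case
  proof (cases "degree q = 0")
    case True
    then obtain a where "q = [:a:]" by (rule degree_eq_zeroE)
    then show ?thesis
      using less.prems(1) invertible_op_scaleR[of 1 a] by (auto simp: invertible_op_def[of 1])
  next
    case False
    then have "\<not> constant (poly (map_poly complex_of_real q))"
      by (simp add: constant_degree degree_map_poly)
    then obtain z where z: "poly (map_poly complex_of_real q) z = 0"
      using fundamental_theorem_of_algebra by blast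
    show ?thesis
    proof (cases "Im z = 0")
      case True
      then have "z = complex_of_real (Re z)"
        by (simp add: complex_eq_iff)
      with z have root: "poly q (Re z) = 0"
        by (metis of_real_eq_0_iff poly_map_poly_of_real)
      then obtain r where "q = [:- Re z, 1:] * r"
        by (auto simp: poly_eq_0_iff_dvd dvd_def)
      moreover have "invertible_op (poly_op [:- Re z, 1:] X)"
        using root less.prems(2)[of "Re z"] by (auto simp: real_spectrum_iff)
      ultimately show ?thesis
        by (rule IH) simp
    next
      case im: False
      define d where "d = [:(Re z)\<^sup>2 + (Im z)\<^sup>2, - 2 * Re z, 1:]"
      have d_z: "poly (map_poly complex_of_real d) z = 0"
        by (simp add: d_def complex_eq_iff map_poly_pCons power2_eq_square algebra_simps)
      \<comment> \<open>\<open>d\<close> is the real quadratic with roots \<open>z\<close> and its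
        conjugate. The remainder \<open>a + b t\<close> modulo \<open>d\<close> has real
        coefficients and vanishes at the nonreal \<open>z\<close>, so it is zero and
        \<open>d\<close> divides \<open>q\<close>.\<close>
      have "degree (q mod d) < 2"
        using degree_mod_less[of d q] by (auto simp: d_def)
      then obtain a b where ab: "q mod d = [:a, b:]"
        by (cases "q mod d" rule: pCons_cases, rename_tac a e, case_tac e rule: pCons_cases)
          (auto split: if_splits)
      have "map_poly complex_of_real q
          = map_poly complex_of_real (q div d) * map_poly complex_of_real d
            + map_poly complex_of_real (q mod d)"
        by (metis div_mult_mod_eq map_poly_of_real_add map_poly_of_real_mult)
      then have "poly (map_poly complex_of_real [:a, b:]) z = 0"
        using z d_z ab by simp
      then have "a = 0 \<and> b = 0"
        using im by (auto simp: map_poly_pCons complex_eq_iff)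
      then have "q = d * (q div d)"
        using ab div_mult_mod_eq[of q d] by (simp add: mult.commute)
      moreover have "invertible_op (poly_op d X)"
      proof (rule coercive_invertible[of _ "(Im z)\<^sup>2"])
        let ?S = "X - Re z *\<^sub>R 1"
        have "poly_op d X - (Im z)\<^sup>2 *\<^sub>R 1 = ?S * ?S"
          using scaleR_left_distrib[of "Re z" "Re z" X] by (simp add: d_def algebra_simps power2_eq_square)
        then show "(Im z)\<^sup>2 *\<^sub>R 1 \<le> poly_op d X"
          unfolding less_eq_bop_def using X
          by (metis positive_op_square selfadj_1 selfadj_diff selfadj_scaleR)
      qed (use X im in \<open>simp_all add: selfadj_poly_op\<close>)
      ultimately show ?thesis
        by (rule IH) (simp add: d_def)
    qed
  qed
qed

text \<open>The difference is positive; were it invertible, it would be coercive with some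
  \<open>c > 0\<close>, and then \<open>sqrt ((norm Y)\<^sup>2 - c)\<close> would already bound
  \<open>Y\<close>, below its norm.\<close>

lemma norm_square_minus_square_not_invertible:
  fixes Y :: "'a::chilbert_space bop"
  assumes Y: "selfadj Y" and nt: "(1::'a bop) \<noteq> 0"
  shows "\<not> invertible_op ((norm Y)\<^sup>2 *\<^sub>R 1 - Y * Y)"
proof
  let ?D = "(norm Y)\<^sup>2 *\<^sub>R 1 - Y * Y"
  assume inv: "invertible_op ?D"
  have D: "Re (cinner x (bop_apply ?D x)) = (norm Y)\<^sup>2 * (norm x)\<^sup>2 - (norm (bop_apply Y x))\<^sup>2" for x
  proof -
    have "cinner x (bop_apply Y (bop_apply Y x)) = complex_of_real ((norm (bop_apply Y x))\<^sup>2)"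
      by (simp add: selfadjD[OF Y, symmetric] cinner_self)
    then show ?thesis
      by (simp add: cinner_diff_right cinner_scaleR_right cinner_self)
  qed
  have sD: "selfadj ?D"
    using Y by (intro selfadj_diff selfadj_scaleR selfadj_mult) simp_all
  have "(norm (bop_apply Y x))\<^sup>2 \<le> (norm Y)\<^sup>2 * (norm x)\<^sup>2" for x
    using power_mono[OF norm_bop_apply[of Y x], of 2] by (simp add: power_mult_distrib)
  then have "strictly_positive ?D"
    using inv sD by (simp only: strictly_positive_def positive_op_iff D) simp
  then obtain c where c: "0 < c" "c *\<^sub>R 1 \<le> ?D"
    by (rule strictly_positive_coercive)
  have le: "(norm (bop_apply Y x))\<^sup>2 \<le> ((norm Y)\<^sup>2 - c) * (norm x)\<^sup>2" for x
    using c(2) by (simp only: le_scaleR_1_iff[OF sD] D left_diff_distrib) (simp add: le_diff_eq add.commute)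
  \<comment> \<open>A nonzero vector is what shows \<open>(norm Y)\<^sup>2 - c\<close> to be
    nonnegative, as a norm bound must be.\<close>
  obtain x :: 'a where "x \<noteq> 0"
    using nt by (metis bop_apply_simps(1,2) bop_eqI)
  have "0 \<le> ((norm Y)\<^sup>2 - c) * (norm x)\<^sup>2"
    using le[of x] zero_le_power2 order_trans by blast
  then have k: "0 \<le> (norm Y)\<^sup>2 - c"
    using \<open>x \<noteq> 0\<close> by (simp add: zero_le_mult_iff not_le)
  have "norm Y \<le> sqrt ((norm Y)\<^sup>2 - c)"
  proof (rule norm_bop_bound)
    fix x
    show "norm (bop_apply Y x) \<le> sqrt ((norm Y)\<^sup>2 - c) * norm x"
      using real_sqrt_le_mono[OF le[of x]] by (simp add: real_sqrt_mult)
  qed (use k in simp)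
  also have "\<dots> < sqrt ((norm Y)\<^sup>2)"
    using c(1) by (intro real_sqrt_less_mono) simp
  finally show False by simp
qed

text \<open>With \<open>N\<close> the norm of \<open>p(X)\<close>, the polynomial
  \<open>N\<^sup>2 - p\<^sup>2\<close> gives a non-invertible operator at \<open>X\<close>, hence
  vanishes at a point of the spectrum by \<open>poly_op_invertible\<close>. So \<open>N\<close> is a
  value of the absolute value of \<open>p\<close> there.\<close>

lemma norm_poly_op_le:
  fixes X :: "'a::chilbert_space bop"
  assumes X: "selfadj X" and le: "\<And>t. t \<in> real_spectrum X \<Longrightarrow> \<bar>poly p t\<bar> \<le> e" and e: "0 \<le> e"
  shows "norm (poly_op p X) \<le> e"
proof (cases "(1::'a bop) = 0")
  case True
  then have "poly_op p X = 0"
    by (metis mult.right_neutral mult_zero_right)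
  then show ?thesis using e by simp
next
  case nt: False
  have attained: "\<exists>t\<in>real_spectrum X. poly ([:(norm (poly_op p X))\<^sup>2:] - p * p) t = 0"
    if "[:(norm (poly_op p X))\<^sup>2:] - p * p \<noteq> 0" for p
  proof (rule ccontr)
    assume "\<not> ?thesis"
    then have "invertible_op (poly_op ([:(norm (poly_op p X))\<^sup>2:] - p * p) X)"
      using that by (intro poly_op_invertible[OF X]) auto
    then show False
      using norm_square_minus_square_not_invertible[OF selfadj_poly_op[OF X] nt]
      by (simp add: poly_op_diff poly_op_mult)
  qed
  have "\<exists>t\<in>real_spectrum X. poly ([:(norm (poly_op p X))\<^sup>2:] - p * p) t = 0"
  proof (cases "[:(norm (poly_op p X))\<^sup>2:] - p * p = 0")
    case True
    \<comment> \<open>If \<open>N\<^sup>2 - p\<^sup>2\<close> is the zero polynomial, any spectral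
      point serves. One exists by \<open>attained\<close> for the identity polynomial, where the
      coefficient of degree 2 is -1.\<close>
    have "coeff ([:(norm (poly_op [:0, 1:] X))\<^sup>2:] - [:0, 1:] * [:0, 1::real:]) 2 \<noteq> 0"
      by (simp add: numeral_2_eq_2)
    then have "[:(norm (poly_op [:0, 1:] X))\<^sup>2:] - [:0, 1:] * [:0, 1::real:] \<noteq> 0"
      by (metis coeff_0)
    from attained[OF this] show ?thesis
      unfolding True by auto
  qed (rule attained)
  then obtain t where t: "t \<in> real_spectrum X" "(norm (poly_op p X))\<^sup>2 = (poly p t)\<^sup>2"
    by (auto simp: power2_eq_square)
  then show ?thesis
    using le[OF t(1)] by (metis abs_norm_cancel abs_le_square_iff order_refl order_trans)
qed

section \<open>Continuous functional calculus\<close>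

text \<open>The relation whose unique solution \<open>cfc\<close> selects. As a relation it admits
  algebraic rules before existence and uniqueness are settled.\<close>

definition is_cfc :: "(real \<Rightarrow> real) \<Rightarrow> 'a::chilbert_space bop \<Rightarrow> 'a bop \<Rightarrow> bool" where
  "is_cfc f X Y \<longleftrightarrow> (\<exists>p. uniform_limit (real_spectrum X) (\<lambda>n. poly (p n)) f sequentially \<and>
      (\<lambda>n. poly_op (p n) X) \<longlonglongrightarrow> Y)"

lemma is_cfcE:
  assumes "is_cfc f X Y"
  obtains p where "uniform_limit (real_spectrum X) (\<lambda>n. poly (p n)) f sequentially"
    "(\<lambda>n. poly_op (p n) X) \<longlonglongrightarrow> Y"
  using assms by (auto simp: is_cfc_def)

lemma is_cfc_poly: "is_cfc (poly p) X (poly_op p X)"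
  unfolding is_cfc_def by (rule exI[of _ "\<lambda>_. p"]) (simp add: uniform_limit_const)

lemma is_cfc_cong:
  assumes "\<And>t. t \<in> real_spectrum X \<Longrightarrow> f t = g t" "is_cfc f X Y"
  shows "is_cfc g X Y"
  using assms unfolding is_cfc_def by (metis (no_types, lifting) uniform_limit_cong')

lemma is_cfc_const: "is_cfc (\<lambda>_. a) X (a *\<^sub>R 1)"
  using is_cfc_cong[OF _ is_cfc_poly[of "[:a:]" X], of "\<lambda>_. a"] by simp

lemma is_cfc_ident: "is_cfc (\<lambda>t. t) X X"
  using is_cfc_cong[OF _ is_cfc_poly[of "[:0, 1:]" X], of "\<lambda>t. t"] by simp

lemma is_cfc_diff:
  assumes "is_cfc f X Y" "is_cfc g X Z"
  shows "is_cfc (\<lambda>t. f t - g t) X (Y - Z)"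
proof -
  obtain p where p: "uniform_limit (real_spectrum X) (\<lambda>n. poly (p n)) f sequentially"
    "(\<lambda>n. poly_op (p n) X) \<longlonglongrightarrow> Y"
    using assms(1) by (rule is_cfcE)
  obtain q where q: "uniform_limit (real_spectrum X) (\<lambda>n. poly (q n)) g sequentially"
    "(\<lambda>n. poly_op (q n) X) \<longlonglongrightarrow> Z"
    using assms(2) by (rule is_cfcE)
  show ?thesis
    unfolding is_cfc_def
    using uniform_limit_minus[OF p(1) q(1)] tendsto_diff[OF p(2) q(2)]
    by (intro exI[of _ "\<lambda>n. p n - q n"]) (simp add: poly_op_diff poly_diff[abs_def])
qed

lemma is_cfc_mult:
  assumes "is_cfc f X Y" "is_cfc g X Z"
    and "bounded (f ` real_spectrum X)" "bounded (g ` real_spectrum X)"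
  shows "is_cfc (\<lambda>t. f t * g t) X (Y * Z)"
proof -
  obtain p where p: "uniform_limit (real_spectrum X) (\<lambda>n. poly (p n)) f sequentially"
    "(\<lambda>n. poly_op (p n) X) \<longlonglongrightarrow> Y"
    using assms(1) by (rule is_cfcE)
  obtain q where q: "uniform_limit (real_spectrum X) (\<lambda>n. poly (q n)) g sequentially"
    "(\<lambda>n. poly_op (q n) X) \<longlonglongrightarrow> Z"
    using assms(2) by (rule is_cfcE)
  show ?thesis
    unfolding is_cfc_def
    using uniform_lim_mult[OF p(1) q(1) assms(3,4)] tendsto_mult[OF p(2) q(2)]
    by (intro exI[of _ "\<lambda>n. p n * q n"]) (simp add: poly_op_mult poly_mult[abs_def])
qed

text \<open>The polynomial bound \<open>norm_poly_op_le\<close> passes to the limit. With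
  \<open>e = 0\<close> it yields uniqueness, with small \<open>e\<close> continuity of powers in the
  exponent.\<close>

lemma is_cfc_norm_diff:
  assumes X: "selfadj X" and Y: "is_cfc f X Y" and Z: "is_cfc g X Z"
    and le: "\<And>t. t \<in> real_spectrum X \<Longrightarrow> \<bar>f t - g t\<bar> \<le> e" and e: "0 \<le> e"
  shows "norm (Y - Z) \<le> e"
proof (rule field_le_epsilon)
  fix d :: real
  assume d: "0 < d"
  obtain p where p: "uniform_limit (real_spectrum X) (\<lambda>n. poly (p n)) (\<lambda>t. f t - g t) sequentially"
    "(\<lambda>n. poly_op (p n) X) \<longlonglongrightarrow> Y - Z"
    using is_cfc_diff[OF Y Z] by (rule is_cfcE)
  have "\<forall>\<^sub>F n in sequentially. norm (poly_op (p n) X) \<le> e + d"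
    using uniform_limitD[OF p(1) d]
  proof eventually_elim
    case (elim n)
    have "\<bar>poly (p n) t\<bar> \<le> e + d" if "t \<in> real_spectrum X" for t
      using le[OF that] elim that by (fastforce simp: dist_real_def)
    then show ?case
      using e d by (intro norm_poly_op_le[OF X]) auto
  qed
  then show "norm (Y - Z) \<le> e + d"
    by (rule tendsto_upperbound[OF tendsto_norm[OF p(2)]]) simp
qed

lemma is_cfc_unique: "selfadj X \<Longrightarrow> is_cfc f X Y \<Longrightarrow> is_cfc f X Z \<Longrightarrow> Y = Z"
  using is_cfc_norm_diff[of X f Y f Z 0] by simp

lemma cfc_eqI: "selfadj X \<Longrightarrow> is_cfc f X Y \<Longrightarrow> cfc f X = Y"
  unfolding cfc_def by (rule the_equality) (auto simp: is_cfc_def real_spectrum_def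
      intro: is_cfc_unique[unfolded is_cfc_def real_spectrum_def])

lemma selfadj_is_cfc:
  assumes X: "selfadj X" and Y: "is_cfc f X Y"
  shows "selfadj Y"
  unfolding selfadj_def
proof (intro allI)
  fix x y
  obtain p where p: "(\<lambda>n. poly_op (p n) X) \<longlonglongrightarrow> Y"
    using Y by (rule is_cfcE)
  have ap: "(\<lambda>n. bop_apply (poly_op (p n) X) z) \<longlonglongrightarrow> bop_apply Y z" for z
    by (rule bounded_linear.tendsto[OF bounded_linear_bop_apply_left p])
  show "cinner (bop_apply Y x) y = cinner x (bop_apply Y y)"
    using tendsto_cinner[OF ap[of x] tendsto_const[of y]]
      tendsto_cinner[OF tendsto_const[of x] ap[of y]] selfadj_poly_op[OF X]
    by (simp add: selfadj_def LIMSEQ_unique)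
qed

lemma is_cfc_commute:
  assumes "is_cfc f X Y" "X * C = C * X"
  shows "Y * C = C * Y"
proof -
  obtain p where p: "(\<lambda>n. poly_op (p n) X) \<longlonglongrightarrow> Y"
    using assms(1) by (rule is_cfcE)
  show ?thesis
    using tendsto_mult[OF p tendsto_const[of C]] tendsto_mult[OF tendsto_const[of C] p]
    by (simp add: poly_op_commute[OF assms(2)] LIMSEQ_unique)
qed

text \<open>Weierstrass polynomials on the interval converge uniformly on the spectrum;
  \<open>norm_poly_op_le\<close> makes their values at \<open>X\<close> a Cauchy sequence, and the
  operators are complete.\<close>

lemma is_cfc_exists:
  assumes X: "selfadj X" and sub: "real_spectrum X \<subseteq> {a..b}" and f: "continuous_on {a..b} f"
  shows "\<exists>Y. is_cfc f X Y"
proof -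
  obtain g where g: "uniform_limit {a..b} g f sequentially"
    and "\<And>n. polynomial_function (g n)"
    using Stone_Weierstrass_uniform_limit[OF compact_Icc f] by blast
  then have "\<exists>p. \<forall>t. g n t = poly p t" for n
  proof -
    obtain c k where "g n = (\<lambda>t. \<Sum>i\<le>k. c i * t ^ i)"
      using \<open>polynomial_function (g n)\<close>
      by (auto simp: real_polynomial_function_eq[symmetric] real_polynomial_function_iff_sum)
    then show ?thesis
      by (intro exI[of _ "\<Sum>i\<le>k. monom (c i) i"]) (simp add: poly_sum poly_monom)
  qed
  then obtain p where p: "g n t = poly (p n) t" for n t by metis
  then have "g = (\<lambda>n. poly (p n))" by blast
  with g have ul: "uniform_limit (real_spectrum X) (\<lambda>n. poly (p n)) f sequentially"
    using sub uniform_limit_on_subset by blast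
  have "Cauchy (\<lambda>n. poly_op (p n) X)"
  proof (rule metric_CauchyI)
    fix e :: real
    assume e: "0 < e"
    obtain N where N: "\<And>n t. n \<ge> N \<Longrightarrow> t \<in> real_spectrum X \<Longrightarrow> dist (poly (p n) t) (f t) < e / 4"
      using ul e unfolding uniform_limit_sequentially_iff by (metis zero_less_divide_iff zero_less_numeral)
    show "\<exists>M. \<forall>m\<ge>M. \<forall>n\<ge>M. dist (poly_op (p m) X) (poly_op (p n) X) < e"
    proof (intro exI allI impI)
      fix m n
      assume mn: "N \<le> m" "N \<le> n"
      have "\<bar>poly (p m - p n) t\<bar> \<le> e / 2" if "t \<in> real_spectrum X" for t
        using N[OF mn(1) that] N[OF mn(2) that] unfolding dist_real_def poly_diff by linarith
      then have "norm (poly_op (p m - p n) X) \<le> e / 2"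
        using e by (intro norm_poly_op_le[OF X]) auto
      then show "dist (poly_op (p m) X) (poly_op (p n) X) < e"
        using e by (simp add: dist_norm poly_op_diff)
    qed
  qed
  then show ?thesis
    using ul by (auto simp: is_cfc_def Cauchy_convergent_iff convergent_def)
qed

text \<open>The square root of \<open>f\<close> is again continuous; its value \<open>S\<close> at
  \<open>X\<close> squares to a value of the calculus at \<open>f\<close>, which is \<open>Y\<close>
  by uniqueness. Scalar inequalities become operator inequalities this way.\<close>

lemma is_cfc_positive:
  assumes X: "selfadj X" and sub: "real_spectrum X \<subseteq> {a..b}" and f: "continuous_on {a..b} f"
    and pos: "\<And>t. t \<in> {a..b} \<Longrightarrow> 0 \<le> f t" and Y: "is_cfc f X Y"
  shows "\<exists>S. selfadj S \<and> S * S = Y"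
proof -
  have c: "continuous_on {a..b} (\<lambda>t. sqrt (f t))"
    by (intro continuous_on_real_sqrt f)
  then obtain S where S: "is_cfc (\<lambda>t. sqrt (f t)) X S"
    using is_cfc_exists[OF X sub] by blast
  have "bounded ((\<lambda>t. sqrt (f t)) ` real_spectrum X)"
    using compact_imp_bounded[OF compact_continuous_image[OF c compact_Icc]] bounded_subset sub
    by (meson image_mono)
  then have "is_cfc (\<lambda>t. sqrt (f t) * sqrt (f t)) X (S * S)"
    by (intro is_cfc_mult S)
  then have "is_cfc f X (S * S)"
    by (rule is_cfc_cong[rotated]) (use pos sub in \<open>auto simp: subset_iff\<close>)
  then show ?thesis
    using is_cfc_unique[OF X Y] selfadj_is_cfc[OF X S] by blast
qed

text \<open>Apply the preceding lemma to the identity function on \<open>{0..norm P}\<close>, an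
  interval containing the spectrum.\<close>

lemma positive_op_sqrt:
  assumes "positive_op P"
  obtains S where "selfadj S" "S * S = P"
proof -
  have X: "selfadj P" using assms by (rule positive_op_selfadj)
  have "0 *\<^sub>R 1 \<le> P"
    using assms by (simp add: positive_op_iff_ge_0)
  then have "real_spectrum P \<subseteq> {0..norm P}"
    using real_spectrum_lower[OF X] real_spectrum_upper[OF X selfadj_le_norm[OF X]] by auto
  from is_cfc_positive[OF X this continuous_on_id _ is_cfc_ident] show thesis
    using that by auto
qed

section \<open>Real powers of strictly positive operators\<close>

text \<open>Coercivity keeps the spectrum in a compact interval away from 0, on which
  \<open>t powr s\<close> is continuous for every real \<open>s\<close>.\<close>

lemma strictly_positive_spectrum:
  assumes X: "strictly_positive X"
  obtains c where "0 < c" "real_spectrum X \<subseteq> {c..norm X}"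
proof -
  have sX: "selfadj X" using X by (rule strictly_positive_selfadj)
  obtain c where c: "0 < c" "c *\<^sub>R 1 \<le> X"
    using X by (rule strictly_positive_coercive)
  show thesis
    by (rule that[OF c(1)])
      (auto intro: real_spectrum_lower[OF sX c(2)] real_spectrum_upper[OF sX selfadj_le_norm[OF sX]])
qed

lemma continuous_on_powr_const: "0 < c \<Longrightarrow> continuous_on {c..b} (\<lambda>t::real. t powr s)"
  by (intro continuous_intros) auto

lemma is_cfc_powr:
  assumes X: "strictly_positive X"
  shows "is_cfc (\<lambda>t. t powr s) X (X powr\<^sub>o\<^sub>p s)"
proof -
  have sX: "selfadj X" using X by (rule strictly_positive_selfadj)
  obtain c where c: "0 < c" "real_spectrum X \<subseteq> {c..norm X}"
    using X by (rule strictly_positive_spectrum)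
  obtain Y where Y: "is_cfc (\<lambda>t. t powr s) X Y"
    using is_cfc_exists[OF sX c(2) continuous_on_powr_const[OF c(1)]] by blast
  then show ?thesis
    using cfc_eqI[OF sX Y] by (simp add: op_powr_def)
qed

lemma op_powr_eqI:
  "strictly_positive X \<Longrightarrow> is_cfc (\<lambda>t. t powr s) X Y \<Longrightarrow> X powr\<^sub>o\<^sub>p s = Y"
  unfolding op_powr_def by (intro cfc_eqI strictly_positive_selfadj)

lemma bounded_powr_spectrum:
  assumes "strictly_positive X"
  shows "bounded ((\<lambda>t. t powr s) ` real_spectrum X)"
proof -
  obtain c where c: "0 < c" "real_spectrum X \<subseteq> {c..norm X}"
    using assms by (rule strictly_positive_spectrum)
  then show ?thesis
    using compact_imp_bounded[OF compact_continuous_image[OF continuous_on_powr_const compact_Icc]]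
    by (meson bounded_subset image_mono)
qed

lemma op_powr_add:
  assumes X: "strictly_positive X"
  shows "X powr\<^sub>o\<^sub>p (r + s) = X powr\<^sub>o\<^sub>p r * X powr\<^sub>o\<^sub>p s"
  using is_cfc_mult[OF is_cfc_powr[OF X] is_cfc_powr[OF X]
      bounded_powr_spectrum[OF X] bounded_powr_spectrum[OF X], of r s]
  by (intro op_powr_eqI[OF X]) (simp add: powr_add)

lemma op_powr_0:
  assumes X: "strictly_positive X"
  shows "X powr\<^sub>o\<^sub>p 0 = 1"
proof (rule op_powr_eqI[OF X])
  obtain c where c: "0 < c" "real_spectrum X \<subseteq> {c..norm X}"
    using X by (rule strictly_positive_spectrum)
  have "is_cfc (\<lambda>_. 1) X 1"
    using is_cfc_const[of 1 X] by simp
  \<comment> \<open>Since \<open>0 powr 0 = 0\<close>, this agreement relies on the spectrum being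
    positive.\<close>
  then show "is_cfc (\<lambda>t. t powr 0) X 1"
    by (rule is_cfc_cong[rotated]) (use c in \<open>auto simp: subset_iff\<close>)
qed

lemma op_powr_1:
  assumes X: "strictly_positive X"
  shows "X powr\<^sub>o\<^sub>p 1 = X"
proof (rule op_powr_eqI[OF X])
  obtain c where c: "0 < c" "real_spectrum X \<subseteq> {c..norm X}"
    using X by (rule strictly_positive_spectrum)
  show "is_cfc (\<lambda>t. t powr 1) X X"
    by (rule is_cfc_cong[OF _ is_cfc_ident]) (use c in \<open>auto simp: subset_iff\<close>)
qed

lemma selfadj_op_powr: "strictly_positive X \<Longrightarrow> selfadj (X powr\<^sub>o\<^sub>p s)"
  using selfadj_is_cfc is_cfc_powr strictly_positive_selfadj by blast

lemma op_powr_minus: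
  assumes X: "strictly_positive X"
  shows "X powr\<^sub>o\<^sub>p s * X powr\<^sub>o\<^sub>p (- s) = 1" "X powr\<^sub>o\<^sub>p (- s) * X powr\<^sub>o\<^sub>p s = 1"
  using op_powr_add[OF X, of s "- s"] op_powr_add[OF X, of "- s" s] op_powr_0[OF X] by simp_all

lemma op_powr_half:
  assumes X: "strictly_positive X"
  shows "X powr\<^sub>o\<^sub>p (s / 2) * X powr\<^sub>o\<^sub>p (s / 2) = X powr\<^sub>o\<^sub>p s"
  using op_powr_add[OF X, of "s / 2" "s / 2"] by simp

text \<open>The power is the square of the self-adjoint power with exponent \<open>s / 2\<close>,
  and the power with exponent \<open>- s\<close> is its inverse.\<close>

lemma strictly_positive_op_powr:
  assumes X: "strictly_positive X"
  shows "strictly_positive (X powr\<^sub>o\<^sub>p s)"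
  unfolding strictly_positive_def invertible_op_def
  using op_powr_minus[OF X, of s] positive_op_square[OF selfadj_op_powr[OF X, of "s / 2"]]
  by (auto simp: op_powr_half[OF X])

lemma op_powr_commute: "strictly_positive X \<Longrightarrow> X * C = C * X \<Longrightarrow> X powr\<^sub>o\<^sub>p s * C = C * X powr\<^sub>o\<^sub>p s"
  using is_cfc_commute is_cfc_powr by blast

lemma strictly_positive_conjugate:
  assumes X: "strictly_positive X" and S: "selfadj S" "invertible_op S"
  shows "strictly_positive (S * X * S)"
  using assms positive_op_conjugate[of S X]
  by (simp add: strictly_positive_def invertible_op_mult)

text \<open>On the spectrum, contained in \<open>{1..norm X}\<close>, the function
  \<open>t powr s - 1\<close> is nonnegative, so its value at \<open>X\<close> is a square of a
  self-adjoint operator.\<close>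

lemma op_powr_ge_1:
  assumes X: "strictly_positive X" and ge: "1 \<le> X" and s: "0 \<le> s"
  shows "1 \<le> X powr\<^sub>o\<^sub>p s"
proof -
  have sX: "selfadj X" using X by (rule strictly_positive_selfadj)
  have sub: "real_spectrum X \<subseteq> {1..norm X}"
    using real_spectrum_lower[OF sX, of 1] real_spectrum_upper[OF sX selfadj_le_norm[OF sX]] ge by auto
  have "is_cfc (\<lambda>t. t powr s - 1) X (X powr\<^sub>o\<^sub>p s - 1)"
    using is_cfc_diff[OF is_cfc_powr[OF X] is_cfc_const[of 1]] by simp
  moreover have "continuous_on {1..norm X} (\<lambda>t. t powr s - 1)"
    by (intro continuous_intros) auto
  ultimately obtain S where "selfadj S" "S * S = X powr\<^sub>o\<^sub>p s - 1"
    using is_cfc_positive[OF sX sub] s by (metis (no_types, lifting) atLeastAtMost_iff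
        diff_ge_0_iff_ge ge_one_powr_ge_zero)
  then show ?thesis
    using positive_op_square[of S] by (simp add: less_eq_bop_def)
qed

lemma op_powr_le_1:
  assumes X: "strictly_positive X" and le: "X \<le> 1" and s: "0 \<le> s"
  shows "X powr\<^sub>o\<^sub>p s \<le> 1"
proof -
  have sX: "selfadj X" using X by (rule strictly_positive_selfadj)
  obtain c where c: "0 < c" "real_spectrum X \<subseteq> {c..norm X}"
    using X by (rule strictly_positive_spectrum)
  then have sub: "real_spectrum X \<subseteq> {c..1}"
    using real_spectrum_upper[OF sX, of 1] le by auto
  have "is_cfc (\<lambda>t. 1 - t powr s) X (1 - X powr\<^sub>o\<^sub>p s)"
    using is_cfc_diff[OF is_cfc_const[of 1] is_cfc_powr[OF X]] by simp
  moreover have "continuous_on {c..1} (\<lambda>t. 1 - t powr s)"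
    using c(1) by (intro continuous_intros) auto
  ultimately obtain S where "selfadj S" "S * S = 1 - X powr\<^sub>o\<^sub>p s"
    using is_cfc_positive[OF sX sub, of "\<lambda>t. 1 - t powr s"] s c(1) powr_le1 by fastforce
  then show ?thesis
    using positive_op_square[of S] by (simp add: less_eq_bop_def)
qed

text \<open>Uniform continuity of \<open>t powr u\<close> in both variables on a compact rectangle
  makes the powers uniformly close on the spectrum for nearby exponents.\<close>

lemma op_powr_tendsto:
  assumes X: "strictly_positive X" and s: "s \<longlonglongrightarrow> r"
  shows "(\<lambda>n. X powr\<^sub>o\<^sub>p s n) \<longlonglongrightarrow> X powr\<^sub>o\<^sub>p r"
proof (rule metric_LIMSEQ_I)
  fix e :: real
  assume e: "0 < e"
  obtain c where c: "0 < c" "real_spectrum X \<subseteq> {c..norm X}"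
    using X by (rule strictly_positive_spectrum)
  let ?K = "{r - 1..r + 1} \<times> {c..norm X}"
  have "continuous_on ?K (\<lambda>(u, t). t powr u)"
    unfolding case_prod_beta using c(1) by (intro continuous_intros) auto
  then have "uniformly_continuous_on ?K (\<lambda>(u, t). t powr u)"
    by (intro compact_uniformly_continuous compact_Times) auto
  then obtain d where d: "0 < d"
    "\<And>x y. x \<in> ?K \<Longrightarrow> y \<in> ?K \<Longrightarrow> dist y x < d \<Longrightarrow>
      dist (case y of (u, t) \<Rightarrow> t powr u) (case x of (u, t) \<Rightarrow> t powr u) < e / 2"
    using e unfolding uniformly_continuous_on_def by (metis half_gt_zero)
  obtain N where N: "\<And>n. n \<ge> N \<Longrightarrow> dist (s n) r < min d 1"
    using metric_LIMSEQ_D[OF s, of "min d 1"] d(1) by auto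
  show "\<exists>N. \<forall>n\<ge>N. dist (X powr\<^sub>o\<^sub>p s n) (X powr\<^sub>o\<^sub>p r) < e"
  proof (intro exI allI impI)
    fix n
    assume "N \<le> n"
    then have n: "dist (s n) r < d" "\<bar>s n - r\<bar> < 1"
      using N[of n] by (auto simp: dist_real_def)
    have "\<bar>t powr s n - t powr r\<bar> \<le> e / 2" if t: "t \<in> real_spectrum X" for t
    proof -
      have "(s n, t) \<in> ?K" "(r, t) \<in> ?K"
        using n(2) c(2) t by auto
      then show ?thesis
        using d(2)[of "(r, t)" "(s n, t)"] n(1) by (simp add: dist_Pair_Pair dist_real_def)
    qed
    then have "norm (X powr\<^sub>o\<^sub>p s n - X powr\<^sub>o\<^sub>p r) \<le> e / 2"
      using e by (intro is_cfc_norm_diff[OF strictly_positive_selfadj[OF X]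
            is_cfc_powr[OF X] is_cfc_powr[OF X]]) auto
    then show "dist (X powr\<^sub>o\<^sub>p s n) (X powr\<^sub>o\<^sub>p r) < e"
      using e by (simp add: dist_norm)
  qed
qed

text \<open>By commutativity \<open>(S - R) * (S + R) = 0\<close>, and \<open>S + R\<close> is
  invertible.\<close>

lemma commuting_sqrt_unique:
  fixes S R :: "'a::chilbert_space bop"
  assumes S: "strictly_positive S" and R: "positive_op R" and comm: "S * R = R * S"
    and eq: "S * S = R * R"
  shows "S = R"
proof -
  have "invertible_op (S + R)"
    using strictly_positive_add[OF S R] by (simp add: strictly_positive_def)
  then obtain Y where Y: "(S + R) * Y = 1"
    by (auto simp: invertible_op_def)
  have "(S - R) * (S + R) = 0"
    by (simp add: algebra_simps comm eq)
  then have "(S - R) * ((S + R) * Y) = 0"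
    by (metis mult.assoc mult_zero_left)
  then show ?thesis by (simp add: Y)
qed

text \<open>Repeated halving of the exponent 1 is settled by uniqueness of commuting square roots:
  each \<open>F r\<close> commutes with \<open>F 1\<close>, hence with its powers. Integer multiples
  follow by adding and cancelling \<open>1 / 2 ^ k\<close>.\<close>

lemma positive_semigroup_dyadic_powr:
  fixes F :: "real \<Rightarrow> 'a::chilbert_space bop"
  assumes add: "\<And>r s. F (r + s) = F r * F s" and sF: "\<And>s. selfadj (F s)"
    and Z: "strictly_positive (F 1)"
  shows "F (of_int j / 2 ^ k) = F 1 powr\<^sub>o\<^sub>p (of_int j / 2 ^ k)"
proof -
  have pF: "positive_op (F s)" for s
    using add[of "s / 2" "s / 2"] positive_op_square[OF sF, of "s / 2"] by simp
  have comm: "F 1 powr\<^sub>o\<^sub>p s * F r = F r * F 1 powr\<^sub>o\<^sub>p s" for s r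
    by (rule op_powr_commute[OF Z]) (simp only: add[symmetric] add.commute)
  have root: "F (1 / 2 ^ k) = F 1 powr\<^sub>o\<^sub>p (1 / 2 ^ k)" for k
  proof (induction k)
    case 0
    then show ?case by (simp add: op_powr_1[OF Z])
  next
    case (Suc k)
    have "F 1 powr\<^sub>o\<^sub>p (1 / 2 ^ Suc k) * F 1 powr\<^sub>o\<^sub>p (1 / 2 ^ Suc k)
        = F (1 / 2 ^ Suc k) * F (1 / 2 ^ Suc k)"
    proof -
      have half: "1 / 2 ^ Suc k + 1 / 2 ^ Suc k = (1 / 2 ^ k :: real)" by simp
      show ?thesis
        by (simp only: add[symmetric] op_powr_add[OF Z, symmetric] half Suc.IH)
    qed
    then show ?case
      by (rule commuting_sqrt_unique[OF strictly_positive_op_powr[OF Z] pF comm, symmetric])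
  qed
  \<comment> \<open>Cancel the invertible \<open>F 1\<close> in
    \<open>F (0 + 1) = F 0 * F 1\<close>.\<close>
  have one: "F 0 = 1"
  proof -
    obtain Y where "F 1 * Y = 1"
      using Z by (auto simp: strictly_positive_def invertible_op_def)
    then show ?thesis
      by (metis add add_0 mult.assoc mult.right_neutral)
  qed
  show ?thesis
  proof (induction j rule: int_induct[where k = 0])
    case base
    then show ?case by (simp add: one op_powr_0[OF Z])
  next
    case (step1 i)
    then show ?case
      by (simp add: add_divide_distrib add root op_powr_add[OF Z])
  next
    case (step2 i)
    let ?u = "1 / 2 ^ k :: real" and ?v = "of_int (i - 1) / 2 ^ k :: real"
    \<comment> \<open>Downward induction: the value at \<open>i\<close> is the value at
      \<open>i - 1\<close> times an invertible factor, which is cancelled on the right.\<close>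
    have v: "of_int i / 2 ^ k = ?v + ?u"
      by (simp add: diff_divide_distrib)
    have "F ?v * F 1 powr\<^sub>o\<^sub>p ?u = F 1 powr\<^sub>o\<^sub>p ?v * F 1 powr\<^sub>o\<^sub>p ?u"
      using step2.IH unfolding v add root op_powr_add[OF Z] .
    then have "F ?v * (F 1 powr\<^sub>o\<^sub>p ?u * F 1 powr\<^sub>o\<^sub>p (- ?u))
        = F 1 powr\<^sub>o\<^sub>p ?v * (F 1 powr\<^sub>o\<^sub>p ?u * F 1 powr\<^sub>o\<^sub>p (- ?u))"
      by (simp only: mult.assoc[symmetric])
    then show ?case
      by (simp only: op_powr_minus[OF Z] mult.right_neutral)
  qed
qed

lemma dyadic_approximation:
  obtains j :: "nat \<Rightarrow> int" where "(\<lambda>k. of_int (j k) / 2 ^ k) \<longlonglongrightarrow> (s::real)"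
proof
  have lim: "(\<lambda>k. (1 / 2) ^ k) \<longlonglongrightarrow> (0::real)"
    by (rule LIMSEQ_realpow_zero) auto
  have "norm (of_int \<lfloor>s * 2 ^ k\<rfloor> / 2 ^ k - s) \<le> (1 / 2) ^ k" for k
  proof -
    have "\<bar>of_int \<lfloor>s * 2 ^ k\<rfloor> - s * 2 ^ k\<bar> \<le> 1" by linarith
    then have "\<bar>of_int \<lfloor>s * 2 ^ k\<rfloor> - s * 2 ^ k\<bar> / 2 ^ k \<le> 1 / 2 ^ k"
      by (intro divide_right_mono) auto
    moreover have "of_int \<lfloor>s * 2 ^ k\<rfloor> / 2 ^ k - s = (of_int \<lfloor>s * 2 ^ k\<rfloor> - s * 2 ^ k) / 2 ^ k"
      by (simp add: diff_divide_distrib)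
    ultimately show ?thesis
      by (simp add: abs_divide power_one_over)
  qed
  then have "(\<lambda>k. of_int \<lfloor>s * 2 ^ k\<rfloor> / 2 ^ k - s) \<longlonglongrightarrow> 0"
    by (intro Lim_null_comparison[OF always_eventually lim]) blast
  then show "(\<lambda>k. of_int \<lfloor>s * 2 ^ k\<rfloor> / 2 ^ k) \<longlonglongrightarrow> s"
    by (simp add: LIM_zero_iff)
qed

section \<open>Tensor products of operators\<close>

text \<open>\<open>G\<close> is the graph of a bounded operator on a dense domain, and the bound
  itself forces it to be single-valued. Its sequential closure \<open>H\<close> is the graph of the
  extension to the whole space.\<close>

lemma bop_from_graph:
  fixes G :: "('c::chilbert_space \<times> 'c) set"
  assumes sub: "subspace G"
    and sc: "\<And>c u v. (u, v) \<in> G \<Longrightarrow> (c *\<^sub>C u, c *\<^sub>C v) \<in> G"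
    and bd: "\<And>u v. (u, v) \<in> G \<Longrightarrow> norm v \<le> K * norm u"
    and K: "0 \<le> K"
    and dense: "closure (fst ` G) = UNIV"
  obtains C where "\<And>u v. (u, v) \<in> G \<Longrightarrow> bop_apply C u = v"
proof -
  define H where "H = {(u, v). \<exists>g h. (\<forall>n. (g n, h n) \<in> G) \<and> g \<longlonglongrightarrow> u \<and> h \<longlonglongrightarrow> v}"
  have HI: "(u, v) \<in> H" if "\<And>n. (g n, h n) \<in> G" "g \<longlonglongrightarrow> u" "h \<longlonglongrightarrow> v" for g h u v
    using that by (auto simp: H_def)
  have HE: "\<exists>g h. (\<forall>n. (g n, h n) \<in> G) \<and> g \<longlonglongrightarrow> u \<and> h \<longlonglongrightarrow> v" if "(u, v) \<in> H" for u v
    using that by (auto simp: H_def)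
  have G_add: "(u + u', v + v') \<in> G" if "(u, v) \<in> G" "(u', v') \<in> G" for u u' v v'
    using subspace_add[OF sub that] by simp
  have G_diff: "(u - u', v - v') \<in> G" if "(u, v) \<in> G" "(u', v') \<in> G" for u u' v v'
    using subspace_diff[OF sub that] by simp
  have H_add: "(u + u', v + v') \<in> H" if H: "(u, v) \<in> H" "(u', v') \<in> H" for u u' v v'
  proof -
    obtain g h g' h' where "\<And>n. (g n, h n) \<in> G" "g \<longlonglongrightarrow> u" "h \<longlonglongrightarrow> v"
      "\<And>n. (g' n, h' n) \<in> G" "g' \<longlonglongrightarrow> u'" "h' \<longlonglongrightarrow> v'"
      using HE[OF H(1)] HE[OF H(2)] by blast
    then show ?thesis
      by (intro HI[of "\<lambda>n. g n + g' n" "\<lambda>n. h n + h' n"] tendsto_intros G_add)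
  qed
  have H_sc: "(c *\<^sub>C u, c *\<^sub>C v) \<in> H" if H: "(u, v) \<in> H" for c u v
  proof -
    obtain g h where "\<And>n. (g n, h n) \<in> G" "g \<longlonglongrightarrow> u" "h \<longlonglongrightarrow> v"
      using HE[OF H] by blast
    then show ?thesis
      by (intro HI[of "\<lambda>n. c *\<^sub>C g n" "\<lambda>n. c *\<^sub>C h n"] sc
          bounded_linear.tendsto[OF bounded_linear_scaleC])
  qed
  have H_bd: "norm v \<le> K * norm u" if H: "(u, v) \<in> H" for u v
  proof -
    obtain g h where "\<And>n. (g n, h n) \<in> G" "g \<longlonglongrightarrow> u" "h \<longlonglongrightarrow> v"
      using HE[OF H] by blast
    then show ?thesis
      using bd by (intro LIMSEQ_le[of "\<lambda>n. norm (h n)" _ "\<lambda>n. K * norm (g n)"] tendsto_intros) auto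
  qed
  \<comment> \<open>Approximate \<open>u\<close> from the domain; the bound makes the image sequence
    Cauchy.\<close>
  have total: "\<exists>v. (u, v) \<in> H" for u
  proof -
    obtain g where g: "\<And>n. g n \<in> fst ` G" "g \<longlonglongrightarrow> u"
      using dense closure_sequential[of u "fst ` G"] by auto
    then have "\<forall>n. \<exists>v. (g n, v) \<in> G" by force
    then obtain h where h: "\<And>n. (g n, h n) \<in> G" by metis
    have "Cauchy h"
    proof (rule metric_CauchyI)
      fix e :: real
      assume e: "0 < e"
      \<comment> \<open>\<open>K + 1\<close> replaces \<open>K\<close> so that \<open>K = 0\<close>
        causes no division by zero.\<close>
      have "0 < e / (K + 1)" using e K by simp
      then obtain M where M: "\<And>m n. M \<le> m \<Longrightarrow> M \<le> n \<Longrightarrow> norm (g m - g n) < e / (K + 1)"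
        using LIMSEQ_imp_Cauchy[OF g(2)] unfolding Cauchy_def dist_norm by meson
      have "dist (h m) (h n) < e" if "M \<le> m" "M \<le> n" for m n
      proof -
        have "norm (h m - h n) \<le> K * norm (g m - g n)"
          by (intro bd G_diff h)
        also have "\<dots> \<le> (K + 1) * norm (g m - g n)"
          by (simp add: distrib_right)
        also have "\<dots> < e"
          using M[OF that] K by (simp add: pos_less_divide_eq mult.commute)
        finally show ?thesis by (simp add: dist_norm)
      qed
      then show "\<exists>M. \<forall>m\<ge>M. \<forall>n\<ge>M. dist (h m) (h n) < e" by blast
    qed
    then obtain v where "h \<longlonglongrightarrow> v"
      by (auto simp: Cauchy_convergent_iff convergent_def)
    then show ?thesis
      using HI[OF h g(2)] by blast
  qed
  then obtain f where f: "\<And>u. (u, f u) \<in> H" by metis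
  have f_eq: "f u = v" if "(u, v) \<in> H" for u v
  proof -
    \<comment> \<open>Single-valuedness: the difference of two pairs over \<open>u\<close> has first
      component 0, so the bound annihilates the second.\<close>
    have "(u + (-1) *\<^sub>C u, f u + (-1) *\<^sub>C v) \<in> H"
      by (intro H_add f H_sc that)
    moreover have "(-1) *\<^sub>C w = - w" for w :: 'c
      using scaleC_of_real[of "-1" w] by simp
    ultimately show ?thesis
      using H_bd[of 0 "f u - v"] by simp
  qed
  have f_add: "f (u + v) = f u + f v" for u v
    by (intro f_eq H_add f)
  have f_sc: "f (c *\<^sub>C u) = c *\<^sub>C f u" for c u
    by (intro f_eq H_sc f)
  have bl: "bounded_linear f"
    by (rule bounded_linear_intro[of _ K])
      (simp_all add: f_add H_bd[OF f] mult.commute[of _ K] f_sc flip: scaleC_of_real)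
  have ap: "bop_apply (Bop (Blinfun f)) u = f u" for u
    by (simp add: bop_apply.rep_eq Bop_inverse bounded_linear_Blinfun_apply[OF bl] f_sc)
  show thesis
  proof (rule that[of "Bop (Blinfun f)"])
    fix u v
    assume "(u, v) \<in> G"
    then have "(u, v) \<in> H"
      by (intro HI[of "\<lambda>_. u" "\<lambda>_. v"]) simp_all
    then show "bop_apply (Bop (Blinfun f)) u = v"
      by (simp add: ap f_eq)
  qed
qed

context
  fixes t :: "'a::chilbert_space \<Rightarrow> 'b::chilbert_space \<Rightarrow> 'c::chilbert_space"
  assumes ht: "hilbert_tensor t"
begin

lemma tensor_add_left: "t (x + x') y = t x y + t x' y"
  and tensor_add_right: "t x (y + y') = t x y + t x y'"
  and tensor_scaleC_left: "t (c *\<^sub>C x) y = c *\<^sub>C t x y"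
  and tensor_scaleC_right: "t x (c *\<^sub>C y) = c *\<^sub>C t x y"
  and tensor_cinner: "cinner (t x y) (t x' y') = cinner x x' * cinner y y'"
  and tensor_dense: "closure (span {t x y | x y. True}) = UNIV"
  using ht by (simp_all add: hilbert_tensor_def)

lemma tensor_scaleR_left: "t (r *\<^sub>R x) y = r *\<^sub>R t x y"
  and tensor_scaleR_right: "t x (r *\<^sub>R y) = r *\<^sub>R t x y"
  by (simp_all add: tensor_scaleC_left tensor_scaleC_right flip: scaleC_of_real)

lemma norm_tensor: "norm (t x y) = norm x * norm y"
proof -
  have "complex_of_real ((norm (t x y))\<^sup>2) = cinner x x * cinner y y"
    by (simp only: tensor_cinner flip: cinner_self)
  also have "\<dots> = complex_of_real ((norm x * norm y)\<^sup>2)"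
    by (simp add: cinner_self power_mult_distrib)
  finally have "(norm (t x y))\<^sup>2 = (norm x * norm y)\<^sup>2"
    unfolding of_real_eq_iff .
  then show ?thesis
    by (simp add: power2_eq_iff_nonneg)
qed

lemma bounded_bilinear_tensor: "bounded_bilinear t"
  by unfold_locales
    (auto simp: tensor_add_left tensor_add_right tensor_scaleR_left tensor_scaleR_right norm_tensor
      intro!: exI[of _ 1])

text \<open>Density as an induction principle: a property that cuts out a closed subspace need only
  be checked on simple tensors.\<close>

lemma tensor_total:
  assumes "closed S" "subspace S" "\<And>x y. t x y \<in> S"
  shows "z \<in> S"
proof -
  have "span {t x y | x y. True} \<subseteq> S"
    using assms by (intro span_minimal) auto
  then have "closure (span {t x y | x y. True}) \<subseteq> S"
    by (rule closure_minimal[OF _ assms(1)])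
  then show ?thesis
    unfolding tensor_dense by blast
qed

lemma bop_eq_on_tensors:
  assumes "\<And>x y. bop_apply C (t x y) = bop_apply D (t x y)"
  shows "C = D"
proof (rule bop_eqI)
  fix z
  have "z \<in> {z. bop_apply C z = bop_apply D z}"
    by (rule tensor_total, intro closed_Collect_eq linear_continuous_on bounded_linear_bop_apply)
      (auto simp: assms subspace_def bop_apply_scaleR_right)
  then show "bop_apply C z = bop_apply D z" by simp
qed

lemma tensor_op_eqI:
  assumes "\<And>x y. bop_apply C (t x y) = t (bop_apply A x) (bop_apply B y)"
  shows "A \<otimes>\<^bsub>t\<^esub> B = C"
  unfolding tensor_op_def using assms by (intro the_equality bop_eq_on_tensors) auto

text \<open>With \<open>S\<^sup>2 = \<parallel>A\<parallel>\<^sup>2 - A\<^sup>2\<close>, a finite sum \<open>u = \<Sum> t x\<^sub>i y\<^sub>i\<close> satisfies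
  \<open>\<parallel>A\<parallel>\<^sup>2 \<parallel>u\<parallel>\<^sup>2 = \<parallel>\<Sum> t (A x\<^sub>i) y\<^sub>i\<parallel>\<^sup>2 + \<parallel>\<Sum> t (S x\<^sub>i) y\<^sub>i\<parallel>\<^sup>2\<close>, so that the map sending
  \<open>t x y\<close> to \<open>t (A x) y\<close> is well defined and bounded on the span.\<close>

lemma tensor_left_exists:
  assumes A: "selfadj A"
  shows "\<exists>C. \<forall>x y. bop_apply C (t x y) = t (bop_apply A x) y"
proof -
  define k where "k = norm A"
  have sAA: "selfadj (A * A)"
    by (simp add: A selfadj_mult)
  have "Re (cinner x (bop_apply (A * A) x)) \<le> k\<^sup>2 * (norm x)\<^sup>2" for x
  proof -
    have "Re (cinner x (bop_apply (A * A) x)) = (norm (bop_apply A x))\<^sup>2"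
      by (simp add: selfadjD[OF A, symmetric] cinner_self)
    also have "\<dots> \<le> (k * norm x)\<^sup>2"
      unfolding k_def by (intro power_mono norm_bop_apply) simp
    finally show ?thesis by (simp add: power_mult_distrib)
  qed
  then have "positive_op (k\<^sup>2 *\<^sub>R 1 - A * A)"
    using sAA by (simp add: le_scaleR_1_iff flip: less_eq_bop_def del: bop_apply_simps)
  then obtain S where S: "selfadj S" "S * S = k\<^sup>2 *\<^sub>R 1 - A * A"
    by (rule positive_op_sqrt)
  have S_cinner: "cinner (bop_apply S x) (bop_apply S x')
      = k\<^sup>2 * cinner x x' - cinner (bop_apply A x) (bop_apply A x')" for x x'
  proof -
    have "cinner (bop_apply S x) (bop_apply S x') = cinner x (bop_apply (S * S) x')"
      by (simp add: selfadjD[OF S(1)])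
    also have "\<dots> = k\<^sup>2 * cinner x x' - cinner (bop_apply A x) (bop_apply A x')"
      unfolding S(2) by (simp add: cinner_diff_right cinner_scaleR_right selfadjD[OF A])
    finally show ?thesis .
  qed
  define gen where "gen = {(t x y, t (bop_apply A x) y, t (bop_apply S x) y) | x y. True}"
  define T where "T = span gen"
  \<comment> \<open>The norm identity in polarized form. It vanishes on generators by
    \<open>S_cinner\<close>; additivity and real homogeneity in each argument carry this over to
    \<open>T\<close>, and the diagonal recovers the identity.\<close>
  define E :: "'c \<times> 'c \<times> 'c \<Rightarrow> 'c \<times> 'c \<times> 'c \<Rightarrow> complex" where
    "E = (\<lambda>(u, v, w) (u', v', w'). k\<^sup>2 * cinner u u' - cinner v v' - cinner w w')"
  have E_right: "E p 0 = 0" "E p (q + q') = E p q + E p q'" "E p (r *\<^sub>R q) = r * E p q" for p q q' r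
    by (simp_all add: E_def split_beta cinner_add_right cinner_scaleR_right algebra_simps)
  have E_left: "E 0 q = 0" "E (p + p') q = E p q + E p' q" "E (r *\<^sub>R p) q = r * E p q" for p p' q r
    by (simp_all add: E_def split_beta cinner_add_left cinner_scaleR_left algebra_simps)
  have sub1: "subspace {q. E p q = 0}" for p
    by (simp add: subspace_def E_right)
  have sub2: "subspace {p. \<forall>q\<in>T. E p q = 0}"
    by (simp add: subspace_def E_left)
  have E_gen: "E p q = 0" if "p \<in> gen" "q \<in> gen" for p q
    using that by (auto simp: gen_def E_def tensor_cinner S_cinner algebra_simps)
  have E_gen_T: "E p q = 0" if "p \<in> gen" "q \<in> T" for p q
    using span_minimal[OF _ sub1[of p], of gen] E_gen that unfolding T_def by blast
  have E_T: "E p q = 0" if "p \<in> T" "q \<in> T" for p q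
    using span_minimal[OF _ sub2, of gen] E_gen_T that unfolding T_def by blast
  \<comment> \<open>The third component has served the norm estimate; dropping it leaves the graph
    to be extended.\<close>
  define G where "G = {(u, v). \<exists>w. (u, v, w) \<in> T}"
  have sT: "subspace T" by (simp add: T_def)
  have sub: "subspace G"
    unfolding subspace_def G_def
    using subspace_0[OF sT] subspace_add[OF sT] subspace_scale[OF sT]
    by (auto simp: zero_prod_def) (metis add_Pair, metis scaleR_Pair)
  \<comment> \<open>\<open>T\<close> is a real span. It is closed under complex scalars because
    scaling a generator by \<open>c\<close> amounts to replacing \<open>x\<close> by
    \<open>c *\<^sub>C x\<close>.\<close>
  have sub3: "subspace {p. (c *\<^sub>C fst p, c *\<^sub>C fst (snd p), c *\<^sub>C snd (snd p)) \<in> T}" for c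
    unfolding subspace_def
    using subspace_0[OF sT] subspace_add[OF sT] subspace_scale[OF sT]
    by (auto simp: zero_prod_def scaleC_add_right scaleC_scaleR_commute)
  have gen_T: "(t x y, t (bop_apply A x) y, t (bop_apply S x) y) \<in> T" for x y
    unfolding T_def gen_def by (rule span_base) blast
  have "(c *\<^sub>C t x y, c *\<^sub>C t (bop_apply A x) y, c *\<^sub>C t (bop_apply S x) y) \<in> T" for c x y
    using gen_T[of "c *\<^sub>C x" y] by (simp add: tensor_scaleC_left bop_apply_scaleC)
  then have "gen \<subseteq> {p. (c *\<^sub>C fst p, c *\<^sub>C fst (snd p), c *\<^sub>C snd (snd p)) \<in> T}" for c
    by (auto simp: gen_def)
  then have T_sc: "T \<subseteq> {p. (c *\<^sub>C fst p, c *\<^sub>C fst (snd p), c *\<^sub>C snd (snd p)) \<in> T}" for c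
    unfolding T_def by (intro span_minimal) (use sub3 T_def in auto)
  have gen_G: "(t x y, t (bop_apply A x) y) \<in> G" for x y
    using gen_T by (auto simp: G_def)
  obtain C where C: "\<And>u v. (u, v) \<in> G \<Longrightarrow> bop_apply C u = v"
  proof (rule bop_from_graph[OF sub, of k])
    show "(c *\<^sub>C u, c *\<^sub>C v) \<in> G" if "(u, v) \<in> G" for c u v
      using that T_sc[of c] by (fastforce simp: G_def)
    show "norm v \<le> k * norm u" if "(u, v) \<in> G" for u v
    proof -
      obtain w where w: "(u, v, w) \<in> T" using \<open>(u, v) \<in> G\<close> by (auto simp: G_def)
      have "complex_of_real (k\<^sup>2 * (norm u)\<^sup>2 - (norm v)\<^sup>2 - (norm w)\<^sup>2) = 0"
        using E_T[OF w w] by (simp add: E_def cinner_self)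
      then have "k\<^sup>2 * (norm u)\<^sup>2 - (norm v)\<^sup>2 - (norm w)\<^sup>2 = 0"
        unfolding of_real_eq_0_iff .
      then have "(norm v)\<^sup>2 \<le> (k * norm u)\<^sup>2"
        using zero_le_power2[of "norm w"] unfolding power_mult_distrib by linarith
      then show ?thesis
        by (rule power2_le_imp_le) (simp add: k_def)
    qed
    have "subspace (fst ` G)"
      by (intro linear_subspace_image sub bounded_linear.linear[OF bounded_linear_fst])
    moreover have "t x y \<in> fst ` G" for x y
      using imageI[OF gen_G, of fst] by simp
    ultimately have "span {t x y | x y. True} \<subseteq> fst ` G"
      by (intro span_minimal) blast
    then show "closure (fst ` G) = UNIV"
      using closure_mono tensor_dense by blast
  qed (auto simp: k_def)
  then show ?thesis using gen_G by blast
qed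

end

text \<open>Exchanging the factors turns the existence result for the left factor into one for the
  right factor.\<close>

lemma hilbert_tensor_swap:
  assumes "hilbert_tensor t"
  shows "hilbert_tensor (\<lambda>y x. t x y)"
proof -
  have "{t x y | y x. True} = {t x y | x y. True}" by blast
  with assms show ?thesis
    by (simp add: hilbert_tensor_def mult.commute)
qed

context
  fixes t :: "'a::chilbert_space \<Rightarrow> 'b::chilbert_space \<Rightarrow> 'c::chilbert_space"
  assumes ht: "hilbert_tensor t"
begin

text \<open>Composing the operators that act on the left and on the right factor alone gives a
  witness for the description in \<open>tensor_op\<close>; self-adjointness enters through
  \<open>tensor_left_exists\<close>.\<close>

lemma tensor_op_apply:
  assumes "selfadj A" "selfadj B"
  shows "bop_apply (A \<otimes>\<^bsub>t\<^esub> B) (t x y) = t (bop_apply A x) (bop_apply B y)"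
proof -
  obtain C where C: "\<And>x y. bop_apply C (t x y) = t (bop_apply A x) y"
    using tensor_left_exists[OF ht assms(1)] by blast
  obtain D where D: "\<And>x y. bop_apply D (t x y) = t x (bop_apply B y)"
    using tensor_left_exists[OF hilbert_tensor_swap[OF ht] assms(2)] by blast
  have CD: "bop_apply (C * D) (t x y) = t (bop_apply A x) (bop_apply B y)" for x y
    by (simp add: C D)
  show ?thesis
    using tensor_op_eqI[OF ht CD] CD by simp
qed

lemma tensor_op_mult:
  assumes "selfadj A" "selfadj B" "selfadj C" "selfadj D"
  shows "(A * C) \<otimes>\<^bsub>t\<^esub> (B * D) = (A \<otimes>\<^bsub>t\<^esub> B) * (C \<otimes>\<^bsub>t\<^esub> D)"
  by (rule tensor_op_eqI[OF ht]) (simp add: tensor_op_apply assms)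

lemma tensor_op_1: "1 \<otimes>\<^bsub>t\<^esub> 1 = 1"
  by (rule tensor_op_eqI[OF ht]) simp

lemma tensor_op_add_left:
  assumes "selfadj A" "selfadj A'" "selfadj B"
  shows "(A + A') \<otimes>\<^bsub>t\<^esub> B = A \<otimes>\<^bsub>t\<^esub> B + A' \<otimes>\<^bsub>t\<^esub> B"
  by (rule tensor_op_eqI[OF ht]) (simp add: tensor_op_apply assms tensor_add_left[OF ht])

lemma tensor_op_add_right:
  assumes "selfadj A" "selfadj B" "selfadj B'"
  shows "A \<otimes>\<^bsub>t\<^esub> (B + B') = A \<otimes>\<^bsub>t\<^esub> B + A \<otimes>\<^bsub>t\<^esub> B'"
  by (rule tensor_op_eqI[OF ht]) (simp add: tensor_op_apply assms tensor_add_right[OF ht])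

lemma tensor_op_scaleR_left:
  assumes "selfadj A" "selfadj B"
  shows "(r *\<^sub>R A) \<otimes>\<^bsub>t\<^esub> B = r *\<^sub>R (A \<otimes>\<^bsub>t\<^esub> B)"
  by (rule tensor_op_eqI[OF ht]) (simp add: tensor_op_apply assms tensor_scaleR_left[OF ht])

lemma tensor_op_scaleR_right:
  assumes "selfadj A" "selfadj B"
  shows "A \<otimes>\<^bsub>t\<^esub> (r *\<^sub>R B) = r *\<^sub>R (A \<otimes>\<^bsub>t\<^esub> B)"
  by (rule tensor_op_eqI[OF ht]) (simp add: tensor_op_apply assms tensor_scaleR_right[OF ht])

text \<open>Two density arguments: symmetry extends from simple tensors first in the second
  argument, then in the first.\<close>

lemma selfadj_tensor_op:
  assumes A: "selfadj A" and B: "selfadj B"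
  shows "selfadj (A \<otimes>\<^bsub>t\<^esub> B)"
proof -
  let ?C = "A \<otimes>\<^bsub>t\<^esub> B"
  have cont: "continuous_on UNIV (\<lambda>v. cinner u (g v))" "continuous_on UNIV (\<lambda>v. cinner (g v) u)"
    if "bounded_linear g" for u and g :: "'c \<Rightarrow> 'c"
    using that by (intro bounded_bilinear.continuous_on[OF bounded_bilinear_cinner]
        linear_continuous_on continuous_on_const; simp)+
  have 1: "cinner (bop_apply ?C (t x y)) v = cinner (t x y) (bop_apply ?C v)" for x y v
  proof -
    have "v \<in> {v. cinner (bop_apply ?C (t x y)) v = cinner (t x y) (bop_apply ?C v)}"
      by (rule tensor_total[OF ht closed_Collect_eq[OF cont(1)[OF bounded_linear_ident]
              cont(1)[OF bounded_linear_bop_apply]]])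
        (auto simp: subspace_def bop_apply_scaleR_right cinner_add_right cinner_scaleR_right
          tensor_op_apply A B tensor_cinner[OF ht] selfadjD[OF A] selfadjD[OF B])
    then show ?thesis by simp
  qed
  have "cinner (bop_apply ?C u) v = cinner u (bop_apply ?C v)" for u v
  proof -
    have "u \<in> {u. cinner (bop_apply ?C u) v = cinner u (bop_apply ?C v)}"
      by (rule tensor_total[OF ht closed_Collect_eq[OF cont(2)[OF bounded_linear_bop_apply]
              cont(2)[OF bounded_linear_ident]]])
        (auto simp: subspace_def bop_apply_scaleR_right cinner_add_left cinner_scaleR_left 1)
    then show ?thesis by simp
  qed
  then show ?thesis by (simp add: selfadj_def)
qed

lemma positive_tensor_op:
  assumes "positive_op A" "positive_op B"
  shows "positive_op (A \<otimes>\<^bsub>t\<^esub> B)"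
proof -
  obtain S R where "selfadj S" "S * S = A" "selfadj R" "R * R = B"
    using assms positive_op_sqrt by metis
  then show ?thesis
    using tensor_op_mult[of S R S R] positive_op_square[OF selfadj_tensor_op[of S R]] by simp
qed

lemma strictly_positive_tensor_op:
  assumes A: "strictly_positive A" and B: "strictly_positive B"
  shows "strictly_positive (A \<otimes>\<^bsub>t\<^esub> B)"
proof -
  have "(A powr\<^sub>o\<^sub>p s \<otimes>\<^bsub>t\<^esub> B powr\<^sub>o\<^sub>p s) * (A powr\<^sub>o\<^sub>p (- s) \<otimes>\<^bsub>t\<^esub> B powr\<^sub>o\<^sub>p (- s)) = 1" for s
    by (simp add: selfadj_op_powr A B op_powr_minus tensor_op_1 flip: tensor_op_mult)
  \<comment> \<open>The cases 1 and -1 show the tensor product of the inverses to be a right and a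
    left inverse.\<close>
  from this[of 1] this[of "-1"] have "invertible_op (A \<otimes>\<^bsub>t\<^esub> B)"
    by (auto simp: invertible_op_def op_powr_1 A B)
  then show ?thesis
    using A B by (simp add: strictly_positive_def positive_tensor_op)
qed

lemma op_powr_tensor_op:
  assumes A: "strictly_positive A" and B: "strictly_positive B"
  shows "(A \<otimes>\<^bsub>t\<^esub> B) powr\<^sub>o\<^sub>p s = A powr\<^sub>o\<^sub>p s \<otimes>\<^bsub>t\<^esub> B powr\<^sub>o\<^sub>p s"
proof -
  define F where "F s = A powr\<^sub>o\<^sub>p s \<otimes>\<^bsub>t\<^esub> B powr\<^sub>o\<^sub>p s" for s
  have sp: "strictly_positive (A \<otimes>\<^bsub>t\<^esub> B)"
    by (intro strictly_positive_tensor_op A B)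
  have F1: "F 1 = A \<otimes>\<^bsub>t\<^esub> B"
    by (simp add: F_def op_powr_1 A B)
  have dyadic: "F (of_int j / 2 ^ k) = F 1 powr\<^sub>o\<^sub>p (of_int j / 2 ^ k)" for j k
  proof (rule positive_semigroup_dyadic_powr)
    show "F (r + s) = F r * F s" for r s
      by (simp add: F_def op_powr_add A B tensor_op_mult selfadj_op_powr)
    show "selfadj (F s)" for s
      by (simp add: F_def selfadj_tensor_op selfadj_op_powr A B)
  qed (simp add: F1 sp)
  obtain j :: "nat \<Rightarrow> int" where j: "(\<lambda>k. of_int (j k) / 2 ^ k) \<longlonglongrightarrow> s"
    by (rule dyadic_approximation)
  \<comment> \<open>Limits are taken after applying operators to vectors, so that continuity of
    \<open>t\<close> itself handles the right-hand side. The type is left general to cover all three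
    spaces.\<close>
  have lim: "(\<lambda>k. bop_apply (X powr\<^sub>o\<^sub>p (of_int (j k) / 2 ^ k)) x) \<longlonglongrightarrow> bop_apply (X powr\<^sub>o\<^sub>p s) x"
    if "strictly_positive X" for X :: "'d::chilbert_space bop" and x
    by (intro bounded_linear.tendsto[OF bounded_linear_bop_apply_left] op_powr_tendsto that j)
  have "bop_apply ((A \<otimes>\<^bsub>t\<^esub> B) powr\<^sub>o\<^sub>p s) (t x y)
      = t (bop_apply (A powr\<^sub>o\<^sub>p s) x) (bop_apply (B powr\<^sub>o\<^sub>p s) y)" for x y
  proof (rule LIMSEQ_unique[OF lim[OF sp]])
    have "bop_apply ((A \<otimes>\<^bsub>t\<^esub> B) powr\<^sub>o\<^sub>p (of_int (j k) / 2 ^ k)) (t x y)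
      = t (bop_apply (A powr\<^sub>o\<^sub>p (of_int (j k) / 2 ^ k)) x)
          (bop_apply (B powr\<^sub>o\<^sub>p (of_int (j k) / 2 ^ k)) y)" for k
      unfolding dyadic[unfolded F1, symmetric] F_def
      by (intro tensor_op_apply selfadj_op_powr A B)
    then show "(\<lambda>k. bop_apply ((A \<otimes>\<^bsub>t\<^esub> B) powr\<^sub>o\<^sub>p (of_int (j k) / 2 ^ k)) (t x y))
      \<longlonglongrightarrow> t (bop_apply (A powr\<^sub>o\<^sub>p s) x) (bop_apply (B powr\<^sub>o\<^sub>p s) y)"
      using bounded_bilinear.tendsto[OF bounded_bilinear_tensor[OF ht] lim[OF A] lim[OF B]]
      by simp
  qed
  then show ?thesis
    by (rule tensor_op_eqI[OF ht, symmetric])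
qed

end

section \<open>Weighted geometric means\<close>

definition geometric_mean :: "real \<Rightarrow> 'a::chilbert_space bop \<Rightarrow> 'a bop \<Rightarrow> 'a bop" where
  "geometric_mean l A B =
     A powr\<^sub>o\<^sub>p (1/2) * (A powr\<^sub>o\<^sub>p (-1/2) * B * A powr\<^sub>o\<^sub>p (-1/2)) powr\<^sub>o\<^sub>p l * A powr\<^sub>o\<^sub>p (1/2)"

lemma tsallis_geometric_mean: "tsallis l A B = (1 / l) *\<^sub>R (geometric_mean l A B - A)"
  by (simp add: tsallis_def geometric_mean_def)

lemma strictly_positive_quotient:
  assumes "strictly_positive A" "strictly_positive B"
  shows "strictly_positive (A powr\<^sub>o\<^sub>p (-1/2) * B * A powr\<^sub>o\<^sub>p (-1/2))"
  using strictly_positive_op_powr[OF assms(1), of "-1/2"]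
  by (intro strictly_positive_conjugate assms selfadj_op_powr) (simp add: strictly_positive_def)

lemma selfadj_geometric_mean:
  assumes "strictly_positive A" "strictly_positive B"
  shows "selfadj (geometric_mean l A B)"
  unfolding geometric_mean_def
  by (intro selfadj_conjugate selfadj_op_powr assms strictly_positive_quotient)

text \<open>Powers commute with tensor products, and a sandwich \<open>S * X * S\<close> of tensor
  products is the tensor product of the sandwiches.\<close>

lemma geometric_mean_tensor_op:
  assumes t: "hilbert_tensor t"
    and A1: "strictly_positive A1" and B1: "strictly_positive B1"
    and A2: "strictly_positive A2" and B2: "strictly_positive B2"
  shows "geometric_mean l (A1 \<otimes>\<^bsub>t\<^esub> A2) (B1 \<otimes>\<^bsub>t\<^esub> B2)
    = geometric_mean l A1 B1 \<otimes>\<^bsub>t\<^esub> geometric_mean l A2 B2"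
proof -
  have conj: "(S1 \<otimes>\<^bsub>t\<^esub> S2) * (X1 \<otimes>\<^bsub>t\<^esub> X2) * (S1 \<otimes>\<^bsub>t\<^esub> S2) = (S1 * X1 * S1) \<otimes>\<^bsub>t\<^esub> (S2 * X2 * S2)"
    if "selfadj S1" "selfadj S2" "selfadj X1" "selfadj X2" for S1 X1 S2 X2
    by (rule tensor_op_eqI[OF t, symmetric]) (simp add: tensor_op_apply[OF t] that)
  show ?thesis
    unfolding geometric_mean_def
    using strictly_positive_quotient[OF A1 B1] strictly_positive_quotient[OF A2 B2]
    by (simp add: op_powr_tensor_op[OF t] conj A1 B1 A2 B2 selfadj_op_powr
        strictly_positive_selfadj)
qed

text \<open>Conjugating \<open>A\<close> by its power -1/2 gives 1, so comparing \<open>A\<close>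
  with \<open>B\<close> becomes comparing 1 with the quotient.\<close>

lemma quotient_minus_1:
  assumes A: "strictly_positive A"
  shows "A powr\<^sub>o\<^sub>p (-1/2) * B * A powr\<^sub>o\<^sub>p (-1/2) - 1
    = A powr\<^sub>o\<^sub>p (-1/2) * (B - A) * A powr\<^sub>o\<^sub>p (-1/2)"
proof -
  have "A powr\<^sub>o\<^sub>p (-1/2) * A powr\<^sub>o\<^sub>p 1 * A powr\<^sub>o\<^sub>p (-1/2) = 1"
    by (simp add: op_powr_0 A flip: op_powr_add)
  then show ?thesis
    by (simp add: op_powr_1 A algebra_simps)
qed

lemma geometric_mean_minus:
  assumes A: "strictly_positive A"
  shows "geometric_mean l A B - A
    = A powr\<^sub>o\<^sub>p (1/2) * ((A powr\<^sub>o\<^sub>p (-1/2) * B * A powr\<^sub>o\<^sub>p (-1/2)) powr\<^sub>o\<^sub>p l - 1) * A powr\<^sub>o\<^sub>p (1/2)"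
  using op_powr_half[OF A, of 1] by (simp add: geometric_mean_def op_powr_1 A algebra_simps)

text \<open>Pass to the quotient, which is at least 1, take the power, which stays at least 1, and
  conjugate back with the power 1/2 of \<open>A\<close>.\<close>

lemma geometric_mean_ge:
  assumes A: "strictly_positive A" and B: "strictly_positive B" and le: "A \<le> B" and l: "0 \<le> l"
  shows "positive_op (geometric_mean l A B - A)"
proof -
  let ?X = "A powr\<^sub>o\<^sub>p (-1/2) * B * A powr\<^sub>o\<^sub>p (-1/2)"
  have "1 \<le> ?X"
    using le unfolding less_eq_bop_def quotient_minus_1[OF A]
    by (intro positive_op_conjugate selfadj_op_powr A)
  then have "1 \<le> ?X powr\<^sub>o\<^sub>p l"
    by (intro op_powr_ge_1 strictly_positive_quotient A B l)
  then show ?thesis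
    unfolding geometric_mean_minus[OF A] less_eq_bop_def
    by (intro positive_op_conjugate selfadj_op_powr A)
qed

lemma geometric_mean_le:
  assumes A: "strictly_positive A" and B: "strictly_positive B" and le: "B \<le> A" and l: "0 \<le> l"
  shows "positive_op (A - geometric_mean l A B)"
proof -
  let ?S = "A powr\<^sub>o\<^sub>p (-1/2)" and ?R = "A powr\<^sub>o\<^sub>p (1/2)"
  have "?S * (A - B) * ?S = 1 - ?S * B * ?S"
    using quotient_minus_1[OF A, of B] by (simp add: algebra_simps)
  then have "?S * B * ?S \<le> 1"
    using le positive_op_conjugate[of ?S "A - B"] by (simp add: less_eq_bop_def selfadj_op_powr A)
  then have "(?S * B * ?S) powr\<^sub>o\<^sub>p l \<le> 1"
    by (intro op_powr_le_1 strictly_positive_quotient A B l)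
  then have "positive_op (?R * (1 - (?S * B * ?S) powr\<^sub>o\<^sub>p l) * ?R)"
    unfolding less_eq_bop_def by (intro positive_op_conjugate selfadj_op_powr A)
  moreover have "A - geometric_mean l A B = ?R * (1 - (?S * B * ?S) powr\<^sub>o\<^sub>p l) * ?R"
    using geometric_mean_minus[OF A, of l B] by (simp add: algebra_simps)
  ultimately show ?thesis by simp
qed

theorem corollary4p8:
  fixes t :: "'a::chilbert_space \<Rightarrow> 'b::chilbert_space \<Rightarrow> 'c::chilbert_space"
    and A1 B1 :: "'a bop" and A2 B2 :: "'b bop" and l :: real
  assumes "hilbert_tensor t"
    and "0 < l" "l \<le> 1"
    and "strictly_positive A1" "strictly_positive B1"
    and "strictly_positive A2" "strictly_positive B2"
  shows
    "(A1 \<le> B1 \<and> A2 \<le> B2 \<longrightarrow>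
        tsallis l (A1 \<otimes>\<^bsub>t\<^esub> A2) (B1 \<otimes>\<^bsub>t\<^esub> B2)
          \<ge> l *\<^sub>R (tsallis l A1 B1 \<otimes>\<^bsub>t\<^esub> tsallis l A2 B2)
      \<and> tsallis l (A1 \<otimes>\<^bsub>t\<^esub> A2) (B1 \<otimes>\<^bsub>t\<^esub> B2)
          \<ge> tsallis l A1 B1 \<otimes>\<^bsub>t\<^esub> A2 + A1 \<otimes>\<^bsub>t\<^esub> tsallis l A2 B2)
     \<and>
     (B1 \<le> A1 \<and> B2 \<le> A2 \<longrightarrow>
        tsallis l (A1 \<otimes>\<^bsub>t\<^esub> A2) (B1 \<otimes>\<^bsub>t\<^esub> B2)
          \<le> l *\<^sub>R (tsallis l A1 B1 \<otimes>\<^bsub>t\<^esub> tsallis l A2 B2)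
      \<and> tsallis l (A1 \<otimes>\<^bsub>t\<^esub> A2) (B1 \<otimes>\<^bsub>t\<^esub> B2)
          \<ge> tsallis l A1 B1 \<otimes>\<^bsub>t\<^esub> A2 + A1 \<otimes>\<^bsub>t\<^esub> tsallis l A2 B2)"
proof -
  note t = assms(1) and l = assms(2) and sp = assms(4-7)
  define D1 where "D1 = geometric_mean l A1 B1 - A1"
  define D2 where "D2 = geometric_mean l A2 B2 - A2"
  have sA: "selfadj A1" "selfadj A2" and pA: "positive_op A1" "positive_op A2"
    using sp by (auto simp: strictly_positive_def positive_op_selfadj)
  have sD: "selfadj D1" "selfadj D2"
    by (simp_all add: D1_def D2_def selfadj_diff selfadj_geometric_mean sp sA)
  have G: "geometric_mean l A1 B1 = A1 + D1" "geometric_mean l A2 B2 = A2 + D2"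
    by (simp_all add: D1_def D2_def)
  let ?DD = "D1 \<otimes>\<^bsub>t\<^esub> D2" and ?DA = "D1 \<otimes>\<^bsub>t\<^esub> A2" and ?AD = "A1 \<otimes>\<^bsub>t\<^esub> D2"
  have T1: "tsallis l A1 B1 = (1 / l) *\<^sub>R D1" and T2: "tsallis l A2 B2 = (1 / l) *\<^sub>R D2"
    by (simp_all add: tsallis_geometric_mean D1_def D2_def)
  have T: "tsallis l (A1 \<otimes>\<^bsub>t\<^esub> A2) (B1 \<otimes>\<^bsub>t\<^esub> B2) = (1 / l) *\<^sub>R (?DD + ?DA + ?AD)"
    by (simp add: tsallis_geometric_mean geometric_mean_tensor_op[OF t] sp G sA sD selfadj_add
        tensor_op_add_left[OF t] tensor_op_add_right[OF t])
  have TT: "l *\<^sub>R (tsallis l A1 B1 \<otimes>\<^bsub>t\<^esub> tsallis l A2 B2) = (1 / l) *\<^sub>R ?DD"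
    using l by (simp add: T1 T2 sD selfadj_scaleR tensor_op_scaleR_left[OF t]
        tensor_op_scaleR_right[OF t])
  have TA: "tsallis l A1 B1 \<otimes>\<^bsub>t\<^esub> A2 + A1 \<otimes>\<^bsub>t\<^esub> tsallis l A2 B2 = (1 / l) *\<^sub>R (?DA + ?AD)"
    by (simp add: T1 T2 sD sA tensor_op_scaleR_left[OF t] tensor_op_scaleR_right[OF t]
        scaleR_add_right)
  have le: "(1 / l) *\<^sub>R X \<le> (1 / l) *\<^sub>R Y" if "positive_op (Y - X)" for X Y :: "'c bop"
    using positive_op_scaleR[OF that, of "1 / l"] l by (simp add: less_eq_bop_def scaleR_diff_right)
  note pos = positive_tensor_op[OF t]
  have neg: "(- X) \<otimes>\<^bsub>t\<^esub> Y = - (X \<otimes>\<^bsub>t\<^esub> Y)" "X \<otimes>\<^bsub>t\<^esub> (- Y) = - (X \<otimes>\<^bsub>t\<^esub> Y)"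
    if "selfadj X" "selfadj Y" for X Y
    using tensor_op_scaleR_left[OF t that, of "-1"] tensor_op_scaleR_right[OF t that, of "-1"]
    by simp_all
  show ?thesis
    unfolding T TT TA
  \<comment> \<open>Both sides carry the factor \<open>1 / l\<close>, so \<open>le\<close> reduces
    each of the four inequalities to positivity of a difference of sums of \<open>?DD\<close>,
    \<open>?DA\<close> and \<open>?AD\<close>.\<close>
  proof (intro conjI impI; elim conjE; rule le)
    assume "A1 \<le> B1" "A2 \<le> B2"
    then have D: "positive_op D1" "positive_op D2"
      using l by (simp_all add: D1_def D2_def geometric_mean_ge sp)
    show "positive_op (?DD + ?DA + ?AD - ?DD)"
      using positive_op_add[OF pos[OF D(1) pA(2)] pos[OF pA(1) D(2)]] by simp
    show "positive_op (?DD + ?DA + ?AD - (?DA + ?AD))"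
      using pos[OF D] by simp
  next
    assume "B1 \<le> A1" "B2 \<le> A2"
    then have D: "positive_op (- D1)" "positive_op (- D2)"
      using l by (simp_all add: D1_def D2_def geometric_mean_le sp)
    \<comment> \<open>What remains is the sum of the positive tensor products of \<open>- D1\<close>
      with \<open>A2\<close> and of \<open>A1\<close> with \<open>- D2\<close>.\<close>
    show "positive_op (?DD - (?DD + ?DA + ?AD))"
      using positive_op_add[OF pos[OF D(1) pA(2)] pos[OF pA(1) D(2)]] by (simp add: neg sA sD)
    \<comment> \<open>The two signs cancel: \<open>?DD\<close> is also the tensor product of the
      positive operators \<open>- D1\<close> and \<open>- D2\<close>.\<close>
    show "positive_op (?DD + ?DA + ?AD - (?DA + ?AD))"
      using pos[OF D] by (simp add: neg sD selfadj_minus)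
  qed
qed

end
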